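(* Let $k\geq 2$ be an integer and let $\varepsilon\in\left(0,\frac{(k-1)^2}{k}\right]$. Let $\mathbf{W}_1,\ldots,\mathbf{W}_m$ be independent random positive semidefinite Hermitian matrices in $\mathbb{C}^{d\times d}$, each with finite support. Suppose that $\sum_{i=1}^m \mathbb{E}\mathbf{W}_i=\mathbf{I}_d$ and that \[ \operatorname{tr}(\mathbb{E}\mathbf{W}_i)\leq \varepsilon,\qquad \operatorname{rank}(\mathbb{E}\mathbf{W}_i)\leq k\qquad\text{for all } i\in\{1,\ldots,m\}. \] Then \[ \mathbb{P}\left[\left\|\sum_{i=1}^m\mathbf{W}_i\right\|\leq\left(\sqrt{1-\frac{\varepsilon}{k-1}}+\sqrt{\varepsilon}\right)^2\right]>0. \]
   Context: $\|\cdot\|$ denotes the operator norm (largest singular value) of a matrix. *)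

theory Defs
  imports "HOL-Probability.Probability"
begin

definition hermitian :: "complex^'n^'n \<Rightarrow> bool" where
  "hermitian A \<longleftrightarrow> (\<forall>i j. A $ i $ j = cnj (A $ j $ i))"

(* The sum is the quadratic form x* A x, which is real for Hermitian A. *)
definition pos_semidef :: "complex^'n^'n \<Rightarrow> bool" where
  "pos_semidef A \<longleftrightarrow>
     hermitian A \<and> (\<forall>x. 0 \<le> Re (\<Sum>i\<in>UNIV. cnj (x $ i) * (A *v x) $ i))"

(* The norm on complex^'n is the Euclidean one, so onorm is the spectral norm,
   i.e. the largest singular value. *)
definition op_norm :: "complex^'n^'n \<Rightarrow> real" where
  "op_norm A = onorm (\<lambda>x. A *v x)"

(* Finiteness of the support of the distribution of X; the values on null sets are irrelevant. *)
definition finitely_supported :: "'w measure \<Rightarrow> ('w \<Rightarrow> 'b) \<Rightarrow> bool" where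
  "finitely_supported M X \<longleftrightarrow> (\<exists>S. finite S \<and> (AE \<omega> in M. X \<omega> \<in> S))"

end

theory Submission
  imports Defs "HOL-Computational_Algebra.Computational_Algebra"
begin

text \<open>The polynomial \<open>h z = det (\<Sum>\<^sub>v z\<^sub>v B\<^sub>v)\<close>, with one variable for each value \<open>B\<^sub>v\<close> of each random
  matrix, is real stable, and so is every \<open>g\<close> obtained from it by operators \<open>1 - D\<^sub>a\<close> with
  \<open>a \<ge> 0\<close>. A point is above the roots of \<open>g\<close> if \<open>g\<close> does not vanish on the orthant above it, and
  \<open>x\<close> is above the roots of \<open>(1 - D\<^sub>a) g\<close> iff it is above the roots of \<open>g\<close> and the barrier
  \<open>D\<^sub>a g / g\<close> is less than \<open>1\<close> at \<open>x\<close>. Starting from \<open>t I\<close>, where the barriers are at most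
  \<open>\<epsilon> / t\<close>, applying \<open>1 - D\<^sub>a\<close> for the mean \<open>a\<close> of one matrix and moving by \<open>\<delta> a\<close> does not
  increase the other barriers, so \<open>(t + \<delta>) I\<close> ends up above all roots. The barrier is linear in
  \<open>a\<close>; hence each mean can be replaced by some value of the random matrix with the same point still
  above the roots. Finally \<open>1 - D\<^sub>a\<close> may be replaced by translation by \<open>-a\<close>, which says that
  \<open>(t + \<delta>) I\<close> exceeds the sum of the chosen values.\<close>

section \<open>Polynomial functions and directional derivatives\<close>

text \<open>Only the means have bounded rank; the values may have any. With one variable per value,
  a mean is a nonnegative direction \<open>a i\<close>, and the rank bound becomes a bound k on the
  degree of \<open>h\<close> along it. The barrier in another direction, restricted to a line along
  \<open>a i\<close>, is a constant plus nonnegative multiples of 1 / (s + l), where the -l are the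
  roots on this line. Setting aside the root at the pole considered, at most k - 1 roots remain, and
  concavity bounds their share of the barrier at distance \<delta> by
  \<open>\<phi> / (1 + \<delta> * \<phi> / (k - 1))\<close> with
  \<open>\<phi> = \<epsilon> / t\<close>. The move is admissible once this is at most
  \<open>1 - 1 / \<delta>\<close>, and minimising t + \<delta> under this condition produces the
  stated norm bound. The hypothesis on \<epsilon> says exactly that the optimal t is not negative.
  It can be 0, and the zero matrix is not above the roots, so the argument runs with a slack \<eta>
  that the finiteness of the supports removes. Independence enters last, to give the selected values
  positive joint probability.\<close>

definition line :: "('v \<Rightarrow> complex) \<Rightarrow> ('v \<Rightarrow> real) \<Rightarrow> complex \<Rightarrow> 'v \<Rightarrow> complex" where
  "line z a s = (\<lambda>v. z v + s * complex_of_real (a v))"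

definition cvec :: "('v \<Rightarrow> real) \<Rightarrow> 'v \<Rightarrow> complex" where
  "cvec x = (\<lambda>v. complex_of_real (x v))"

lemma line_0 [simp]: "line z a 0 = z"
  by (simp add: line_def)

lemma line_line: "line (line z a s) a t = line z a (s + t)"
  by (simp add: line_def algebra_simps)

lemma line_commute: "line (line z a s) b t = line (line z b t) a s"
  by (simp add: line_def algebra_simps)

lemma line_cvec: "line (cvec x) a (complex_of_real s) = cvec (\<lambda>v. x v + s * a v)"
  by (simp add: line_def cvec_def)

text \<open>Polynomials are functions here: the variables will be pairs of an index and a matrix, an
  infinite type, and the arguments restrict to lines or planes, where formal univariate polynomials
  are recovered.\<close>

inductive polynomial_fun :: "(('v \<Rightarrow> complex) \<Rightarrow> complex) \<Rightarrow> bool" where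
  const: "polynomial_fun (\<lambda>z. c)"
| var: "polynomial_fun (\<lambda>z. z v)"
| add: "polynomial_fun f \<Longrightarrow> polynomial_fun g \<Longrightarrow> polynomial_fun (\<lambda>z. f z + g z)"
| mult: "polynomial_fun f \<Longrightarrow> polynomial_fun g \<Longrightarrow> polynomial_fun (\<lambda>z. f z * g z)"

lemma polynomial_fun_diff:
  assumes "polynomial_fun f" "polynomial_fun g"
  shows "polynomial_fun (\<lambda>z. f z - g z)"
  using polynomial_fun.add[OF assms(1) polynomial_fun.mult[OF polynomial_fun.const[of "-1"] assms(2)]]
  by simp

lemma polynomial_fun_sum:
  "(\<And>i. i \<in> A \<Longrightarrow> polynomial_fun (f i)) \<Longrightarrow> polynomial_fun (\<lambda>z. \<Sum>i\<in>A. f i z)"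
  by (induction A rule: infinite_finite_induct) (auto intro: polynomial_fun.intros)

lemma polynomial_fun_prod:
  "(\<And>i. i \<in> A \<Longrightarrow> polynomial_fun (f i)) \<Longrightarrow> polynomial_fun (\<lambda>z. \<Prod>i\<in>A. f i z)"
  by (induction A rule: infinite_finite_induct) (auto intro: polynomial_fun.intros)

text \<open>Two directions at once, because a degree bound along \<open>a\<close> has to survive
  differentiation along \<open>b\<close>. The outer variable of \<open>P\<close> is t: substituting
  \<open>[:t:]\<close> leaves a polynomial in s.\<close>

lemma polynomial_fun_plane:
  assumes "polynomial_fun g"
  obtains P :: "complex poly poly"
  where "\<And>s t. g (line (line z a s) b t) = poly (poly P [:t:]) s"
proof -
  have "\<exists>P. \<forall>s t. g (line (line z a s) b t) = poly (poly P [:t:]) s"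
    using assms
  proof (induction rule: polynomial_fun.induct)
    case (const c)
    show ?case by (rule exI[of _ "[:[:c:]:]"]) simp
  next
    case (var v)
    show ?case
      by (rule exI[of _ "[:[:z v, of_real (a v):], [:of_real (b v):]:]"])
        (simp add: line_def algebra_simps)
  next
    case (add f g)
    then obtain P Q where "\<forall>s t. f (line (line z a s) b t) = poly (poly P [:t:]) s"
      "\<forall>s t. g (line (line z a s) b t) = poly (poly Q [:t:]) s" by blast
    then show ?case by (intro exI[of _ "P + Q"]) simp
  next
    case (mult f g)
    then obtain P Q where "\<forall>s t. f (line (line z a s) b t) = poly (poly P [:t:]) s"
      "\<forall>s t. g (line (line z a s) b t) = poly (poly Q [:t:]) s" by blast
    then show ?case by (intro exI[of _ "P * Q"]) simp
  qed
  then show ?thesis using that by blast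
qed

lemma polynomial_fun_line:
  assumes "polynomial_fun g"
  obtains p where "\<And>s. g (line z a s) = poly p s"
proof -
  obtain P :: "complex poly poly"
    where P: "\<And>s t. g (line (line z a s) a t) = poly (poly P [:t:]) s"
    using polynomial_fun_plane[OF assms] by blast
  show ?thesis
    by (rule that[of "poly P [:0:]"]) (use P[of _ 0] in simp)
qed

definition dderiv :: "('v \<Rightarrow> real) \<Rightarrow> (('v \<Rightarrow> complex) \<Rightarrow> complex) \<Rightarrow> ('v \<Rightarrow> complex) \<Rightarrow> complex" where
  "dderiv a g z = deriv (\<lambda>s. g (line z a s)) 0"

lemma dderiv_eq_pderiv:
  assumes "\<And>s. g (line z a s) = poly p s"
  shows "dderiv a g (line z a s) = poly (pderiv p) s"
proof -
  have "(\<lambda>t. g (line (line z a s) a t)) = (\<lambda>t. poly p (s + t))"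
    using assms by (simp add: line_line)
  moreover have "((\<lambda>t. poly p (s + t)) has_field_derivative poly (pderiv p) s) (at 0)"
    by (auto intro!: derivative_eq_intros)
  ultimately show ?thesis
    unfolding dderiv_def by (simp add: DERIV_imp_deriv)
qed

lemma dderiv_eq_pderiv_0:
  assumes "\<And>s. g (line z a s) = poly p s"
  shows "dderiv a g z = poly (pderiv p) 0"
  using dderiv_eq_pderiv[of g z a p 0] assms by simp

lemma has_field_derivative_line:
  assumes "polynomial_fun g"
  shows "((\<lambda>s. g (line z a s)) has_field_derivative dderiv a g (line z a s)) (at s)"
proof -
  obtain p where p: "\<And>s. g (line z a s) = poly p s"
    using polynomial_fun_line[OF assms] by blast
  show ?thesis
    unfolding dderiv_eq_pderiv[OF p] unfolding p by (rule poly_DERIV)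
qed

lemma has_field_derivative_line_0:
  assumes "polynomial_fun g"
  shows "((\<lambda>s. g (line z a s)) has_field_derivative dderiv a g z) (at 0)"
  using has_field_derivative_line[OF assms, of z a 0] by simp

lemma dderiv_const [simp]: "dderiv a (\<lambda>z. c) = (\<lambda>z. 0)"
  by (simp add: dderiv_def fun_eq_iff)

lemma dderiv_var [simp]: "dderiv a (\<lambda>z. z v) = (\<lambda>z. complex_of_real (a v))"
  unfolding dderiv_def line_def
  by (intro ext DERIV_imp_deriv) (auto intro!: derivative_eq_intros)

lemma dderiv_add:
  assumes "polynomial_fun f" "polynomial_fun g"
  shows "dderiv a (\<lambda>z. f z + g z) = (\<lambda>z. dderiv a f z + dderiv a g z)"
proof
  fix z
  show "dderiv a (\<lambda>z. f z + g z) z = dderiv a f z + dderiv a g z"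
    unfolding dderiv_def[of a "\<lambda>z. f z + g z"]
    by (rule DERIV_imp_deriv, rule derivative_eq_intros,
        rule has_field_derivative_line_0[OF assms(1)],
        rule has_field_derivative_line_0[OF assms(2)], simp)
qed

lemma dderiv_mult:
  assumes "polynomial_fun f" "polynomial_fun g"
  shows "dderiv a (\<lambda>z. f z * g z) = (\<lambda>z. dderiv a f z * g z + f z * dderiv a g z)"
proof
  fix z
  show "dderiv a (\<lambda>z. f z * g z) z = dderiv a f z * g z + f z * dderiv a g z"
    unfolding dderiv_def[of a "\<lambda>z. f z * g z"]
    by (rule DERIV_imp_deriv, rule derivative_eq_intros,
        rule has_field_derivative_line_0[OF assms(1)],
        rule has_field_derivative_line_0[OF assms(2)], simp)
qed

lemma polynomial_fun_dderiv:
  "polynomial_fun g \<Longrightarrow> polynomial_fun (dderiv a g)"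
  by (induction rule: polynomial_fun.induct)
    (auto simp: dderiv_add dderiv_mult intro!: polynomial_fun.intros)

lemma dderiv_commute:
  "polynomial_fun g \<Longrightarrow> dderiv a (dderiv b g) = dderiv b (dderiv a g)"
  by (induction rule: polynomial_fun.induct)
    (simp_all add: dderiv_add dderiv_mult polynomial_fun_dderiv polynomial_fun.mult algebra_simps)

text \<open>Linearity in the direction is what lets an average over values be traded for a single
  value.\<close>

lemma dderiv_lincomb:
  assumes "polynomial_fun g"
  shows "dderiv (\<lambda>v. \<Sum>i\<in>I. p i * e i v) g z = (\<Sum>i\<in>I. of_real (p i) * dderiv (e i) g z)"
  using assms
proof (induction rule: polynomial_fun.induct)
  case (mult f g)
  then show ?case
    by (simp add: dderiv_mult sum_distrib_left sum_distrib_right sum.distrib algebra_simps)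
qed (simp_all add: dderiv_add sum.distrib algebra_simps)

definition dminus :: "('v \<Rightarrow> real) \<Rightarrow> (('v \<Rightarrow> complex) \<Rightarrow> complex) \<Rightarrow> ('v \<Rightarrow> complex) \<Rightarrow> complex" where
  "dminus a g = (\<lambda>z. g z - dderiv a g z)"

lemma dderiv_diff:
  assumes "polynomial_fun f" "polynomial_fun g"
  shows "dderiv a (\<lambda>z. f z - g z) = (\<lambda>z. dderiv a f z - dderiv a g z)"
  using dderiv_add[OF assms(1) polynomial_fun.mult[OF polynomial_fun.const[of "-1"] assms(2)], of a]
    dderiv_mult[OF polynomial_fun.const[of "-1"] assms(2), of a]
  by simp

lemma polynomial_fun_dminus: "polynomial_fun g \<Longrightarrow> polynomial_fun (dminus a g)"
  unfolding dminus_def by (intro polynomial_fun_diff polynomial_fun_dderiv)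

lemma dminus_commute:
  "polynomial_fun g \<Longrightarrow> dminus a (dminus b g) = dminus b (dminus a g)"
  by (simp add: dminus_def dderiv_diff polynomial_fun_dderiv dderiv_commute[of g a b] algebra_simps)

section \<open>Degree along a direction\<close>

definition line_degree_le :: "('v \<Rightarrow> real) \<Rightarrow> nat \<Rightarrow> (('v \<Rightarrow> complex) \<Rightarrow> complex) \<Rightarrow> bool" where
  "line_degree_le a k g \<longleftrightarrow> (\<forall>z. \<exists>p. degree p \<le> k \<and> (\<forall>s. g (line z a s) = poly p s))"

lemma line_degree_leD:
  assumes "line_degree_le a k g" "\<And>s. g (line z a s) = poly p s"
  shows "degree p \<le> k"
proof -
  obtain q where q: "degree q \<le> k" "\<And>s. g (line z a s) = poly q s"
    using assms(1) unfolding line_degree_le_def by metis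
  then have "poly p = poly q" using assms(2) by (simp add: fun_eq_iff)
  then have "p = q" by (simp add: poly_eq_poly_eq_iff)
  with q show ?thesis by simp
qed

lemma poly_map_coeff:
  fixes P :: "'a::comm_ring_1 poly poly"
  shows "coeff (poly P [:t:]) n = poly (map_poly (\<lambda>c. coeff c n) P) t"
proof (induction P)
  case (pCons c P)
  have "map_poly (\<lambda>c. coeff c n) (pCons c P) = pCons (coeff c n) (map_poly (\<lambda>c. coeff c n) P)"
    by (rule map_poly_pCons) simp
  with pCons show ?case by simp
qed simp

text \<open>For n > k the coefficient of s^n vanishes at every t, hence as a polynomial in t. In
  particular its linear term in t vanishes, and the linear term in t is the derivative along
  \<open>b\<close>.\<close>

lemma line_degree_le_dderiv:
  assumes g: "polynomial_fun g" and deg: "line_degree_le a k g"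
  shows "line_degree_le a k (dderiv b g)"
  unfolding line_degree_le_def
proof
  fix z
  obtain P :: "complex poly poly"
    where P: "\<And>s t. g (line (line z a s) b t) = poly (poly P [:t:]) s"
    using polynomial_fun_plane[OF g] by blast
  have "coeff (coeff P j) n = 0" if n: "n > k" for j n
  proof -
    have "degree (poly P [:t:]) \<le> k" for t
      by (rule line_degree_leD[OF deg, of "line z b t"]) (simp add: line_commute P)
    then have "degree (poly P [:t:]) < n" for t
      using n le_less_trans by blast
    then have "poly (map_poly (\<lambda>c. coeff c n) P) t = 0" for t
      by (simp flip: poly_map_coeff add: coeff_eq_0)
    then have "map_poly (\<lambda>c. coeff c n) P = 0"
      using poly_all_0_iff_0 by blast
    then have "coeff (map_poly (\<lambda>c. coeff c n) P) j = 0" by simp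
    then show ?thesis by (simp add: coeff_map_poly)
  qed
  then have "degree (coeff P 1) \<le> k" by (intro degree_le) auto
  moreover have "dderiv b g (line z a s) = poly (coeff P 1) s" for s
  proof -
    have "g (line (line z a s) b t) = poly (map_poly (\<lambda>c. poly c s) P) t" for t
    proof -
      have "poly (poly Q [:t:]) s = poly (map_poly (\<lambda>c. poly c s) Q) t" for Q :: "complex poly poly"
        by (induction Q) (simp_all add: map_poly_pCons)
      then show ?thesis using P by simp
    qed
    then have "dderiv b g (line z a s) = poly (pderiv (map_poly (\<lambda>c. poly c s) P)) 0"
      by (rule dderiv_eq_pderiv_0)
    then show ?thesis
      by (simp add: poly_0_coeff_0 coeff_pderiv coeff_map_poly)
  qed
  ultimately show "\<exists>p. degree p \<le> k \<and> (\<forall>s. dderiv b g (line z a s) = poly p s)"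
    by blast
qed

lemma line_degree_le_dminus:
  assumes "polynomial_fun g" "line_degree_le a k g"
  shows "line_degree_le a k (dminus b g)"
  unfolding line_degree_le_def
proof
  fix z
  obtain p q where "degree p \<le> k" "\<forall>s. g (line z a s) = poly p s"
    "degree q \<le> k" "\<forall>s. dderiv b g (line z a s) = poly q s"
    using assms line_degree_le_dderiv[OF assms] unfolding line_degree_le_def by metis
  then show "\<exists>p. degree p \<le> k \<and> (\<forall>s. dminus b g (line z a s) = poly p s)"
    by (intro exI[of _ "p - q"]) (simp add: dminus_def degree_diff_le)
qed

section \<open>Real stable polynomials\<close>

lemma poly_prod_mset_linear:
  fixes A :: "'a::idom multiset"
  shows "poly (\<Prod>r\<in>#A. [:- r, 1:]) z = (\<Prod>r\<in>#A. z - r)"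
  by (induction A) (auto simp: algebra_simps)

lemma logderiv_prod_mset_linear:
  fixes A :: "complex multiset"
  assumes "z \<notin># A" "c \<noteq> 0"
  shows "poly (pderiv (smult c (\<Prod>r\<in>#A. [:- r, 1:]))) z / poly (smult c (\<Prod>r\<in>#A. [:- r, 1:])) z
    = (\<Sum>r\<in>#A. 1 / (z - r))"
  using assms(1)
proof (induction A)
  case (add r A)
  let ?p = "\<Prod>r\<in>#A. [:- r, 1:]"
  have nz: "z - r \<noteq> 0" "poly ?p z \<noteq> 0"
    using add.prems by (auto simp: poly_prod_mset_linear)
  have IH: "poly (pderiv ?p) z / poly ?p z = (\<Sum>r\<in>#A. 1 / (z - r))"
    using add.IH add.prems assms(2) by (simp add: pderiv_smult)
  have "pderiv ([:- r, 1:] * ?p) = [:- r, 1:] * pderiv ?p + ?p"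
    by (simp only: pderiv_mult) (simp add: pderiv_pCons)
  then have "poly (pderiv ([:- r, 1:] * ?p)) z / poly ([:- r, 1:] * ?p) z
      = ((z - r) * poly (pderiv ?p) z + poly ?p z) / ((z - r) * poly ?p z)"
    by (simp only: poly_add poly_mult) (simp add: algebra_simps)
  also have "\<dots> = poly (pderiv ?p) z / poly ?p z + 1 / (z - r)"
    using nz by (simp add: add_divide_distrib)
  finally have "poly (pderiv ([:- r, 1:] * ?p)) z / poly ([:- r, 1:] * ?p) z
      = (\<Sum>r\<in>#add_mset r A. 1 / (z - r))"
    by (simp add: IH)
  then show ?case using assms(2) by (simp add: pderiv_smult)
qed simp

lemma logderiv_proots:
  fixes p :: "complex poly"
  assumes "poly p z \<noteq> 0"
  shows "poly (pderiv p) z / poly p z = (\<Sum>r\<in>#proots p. 1 / (z - r))"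
proof -
  have "p \<noteq> 0" using assms by auto
  then have "z \<notin># proots p" "lead_coeff p \<noteq> 0"
    using assms by auto
  from logderiv_prod_mset_linear[OF this] show ?thesis
    by (simp only: complex_poly_decompose_multiset)
qed

text \<open>p'(0) / p(0) is the sum of -1 / r over the roots r, and each term has negative imaginary
  part when r lies in the lower half plane. So the quotient is 0 or nonreal, in particular never
  1.\<close>

lemma Im_logderiv_neg:
  fixes p :: "complex poly"
  assumes p: "p \<noteq> 0" and roots: "\<And>r. poly p r = 0 \<Longrightarrow> Im r < 0"
  shows "Im (poly (pderiv p) 0 / poly p 0) \<le> 0" "poly p 0 \<noteq> poly (pderiv p) 0"
proof -
  have nz: "poly p 0 \<noteq> 0" using roots[of 0] by auto
  have *: "A = {#} \<or> Im (\<Sum>r\<in>#A. 1 / (0 - r)) < 0"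
    if "\<And>r. r \<in># A \<Longrightarrow> Im r < 0" for A :: "complex multiset"
    using that
  proof (induction A)
    case (add r A)
    have "r \<noteq> 0" using add.prems[of r] by auto
    then have "(Re r)\<^sup>2 + (Im r)\<^sup>2 > 0"
      by (metis complex_eq_iff sum_power2_gt_zero_iff zero_complex.sel)
    then have "Im (1 / (0 - r)) < 0"
      using add.prems[of r] by (simp add: Im_divide divide_less_0_iff)
    moreover have "A = {#} \<or> Im (\<Sum>r\<in>#A. 1 / (0 - r)) < 0"
      using add by auto
    ultimately show ?case by auto
  qed simp
  have "proots p = {#} \<or> Im (\<Sum>r\<in>#proots p. 1 / (0 - r)) < 0"
    by (rule *) (use p roots in auto)
  then have "poly (pderiv p) 0 / poly p 0 = 0 \<or> Im (poly (pderiv p) 0 / poly p 0) < 0"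
    using logderiv_proots[OF nz] by auto
  then show "Im (poly (pderiv p) 0 / poly p 0) \<le> 0" "poly p 0 \<noteq> poly (pderiv p) 0"
    using nz by auto
qed

text \<open>Moving up from a point of the closed upper half plane lengthens the distance to every
  root, hence every linear factor.\<close>

lemma norm_poly_mono_Im:
  fixes p :: "complex poly"
  assumes roots: "\<And>r. poly p r = 0 \<Longrightarrow> Im r < 0" and "Re s = Re s'" "0 \<le> Im s" "Im s \<le> Im s'"
  shows "norm (poly p s) \<le> norm (poly p s')"
proof (cases "p = 0")
  case False
  have *: "norm (\<Prod>r\<in>#A. s - r) \<le> norm (\<Prod>r\<in>#A. s' - r)"
    if "\<And>r. r \<in># A \<Longrightarrow> Im r < 0" for A
    using that
  proof (induction A)
    case (add r A)
    have "norm (s - r) \<le> norm (s' - r)"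
      using add.prems[of r] assms(2-4)
      by (auto simp: cmod_def intro!: power_mono)
    with add show ?case by (auto simp: norm_mult intro!: mult_mono)
  qed simp
  have "poly p w = lead_coeff p * (\<Prod>r\<in>#proots p. w - r)" for w
    by (metis complex_poly_decompose_multiset poly_prod_mset_linear poly_smult)
  moreover have "norm (\<Prod>r\<in>#proots p. s - r) \<le> norm (\<Prod>r\<in>#proots p. s' - r)"
    by (rule *) (use False roots in auto)
  ultimately show ?thesis
    by (simp add: norm_mult mult_left_mono)
qed simp

text \<open>Reality of the coefficients is stated as commuting with conjugation, since a polynomial
  function carries no coefficients.\<close>

definition real_stable :: "(('v \<Rightarrow> complex) \<Rightarrow> complex) \<Rightarrow> bool" where
  "real_stable g \<longleftrightarrow> polynomial_fun g \<and> (\<forall>z. g (\<lambda>v. cnj (z v)) = cnj (g z)) \<and>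
     (\<forall>z. (\<forall>v. Im (z v) > 0) \<longrightarrow> g z \<noteq> 0)"

lemma real_stable_poly: "real_stable g \<Longrightarrow> polynomial_fun g"
  and real_stable_cnj: "real_stable g \<Longrightarrow> g (\<lambda>v. cnj (z v)) = cnj (g z)"
  and real_stable_nz: "real_stable g \<Longrightarrow> (\<And>v. Im (z v) > 0) \<Longrightarrow> g z \<noteq> 0"
  by (auto simp: real_stable_def)

lemma poly_cnj_eq:
  "poly (map_poly cnj p) z = cnj (poly p (cnj z))"
  by (induction p) (simp_all add: map_poly_pCons)

lemma dderiv_cnj:
  assumes "real_stable g"
  shows "dderiv a g (\<lambda>v. cnj (z v)) = cnj (dderiv a g z)"
proof -
  obtain p where p: "\<And>s. g (line z a s) = poly p s"
    using polynomial_fun_line[OF real_stable_poly[OF assms]] by blast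
  have "g (line (\<lambda>v. cnj (z v)) a s) = poly (map_poly cnj p) s" for s
  proof -
    have "line (\<lambda>v. cnj (z v)) a s = (\<lambda>v. cnj (line z a (cnj s) v))"
      by (simp add: line_def)
    then show ?thesis
      using real_stable_cnj[OF assms] by (simp add: p poly_cnj_eq)
  qed
  from dderiv_eq_pderiv_0[of g, OF this] dderiv_eq_pderiv_0[of g, OF p] show ?thesis
    by (simp add: poly_0_coeff_0 coeff_pderiv coeff_map_poly)
qed

lemma real_stable_line_roots:
  assumes g: "real_stable g" and z: "\<And>v. Im (z v) > 0" and a: "\<And>v. a v \<ge> 0"
    and p: "\<And>s. g (line z a s) = poly p s"
  shows "p \<noteq> 0" "\<And>r. poly p r = 0 \<Longrightarrow> Im r < 0"
proof -
  have *: "poly p r \<noteq> 0" if "Im r \<ge> 0" for r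
  proof -
    have "Im (line z a r v) > 0" for v
      using z[of v] a[of v] that by (simp add: line_def add_pos_nonneg)
    then show ?thesis using real_stable_nz[OF g] p by metis
  qed
  show "p \<noteq> 0" using *[of 0] by auto
  show "\<And>r. poly p r = 0 \<Longrightarrow> Im r < 0" using * by (meson not_le)
qed

text \<open>Where all imaginary parts are positive, the quotient of \<open>dderiv a g\<close> by g
  is the logarithmic derivative of a restriction with all roots in the lower half plane, so it
  cannot equal 1.\<close>

lemma real_stable_dminus:
  assumes g: "real_stable g" and a: "\<And>v. a v \<ge> 0"
  shows "real_stable (dminus a g)"
  unfolding real_stable_def
proof (intro conjI allI impI)
  show "polynomial_fun (dminus a g)"
    using real_stable_poly[OF g] by (rule polynomial_fun_dminus)
  show "dminus a g (\<lambda>v. cnj (z v)) = cnj (dminus a g z)" for z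
    by (simp add: dminus_def real_stable_cnj[OF g] dderiv_cnj[OF g])
  fix z :: "'a \<Rightarrow> complex" assume z: "\<forall>v. Im (z v) > 0"
  obtain p where p: "\<And>s. g (line z a s) = poly p s"
    using polynomial_fun_line[OF real_stable_poly[OF g]] by blast
  have "poly p 0 \<noteq> poly (pderiv p) 0"
    using Im_logderiv_neg(2) real_stable_line_roots[OF g _ a p] z by blast
  moreover have "g z = poly p 0" using p[of 0] by simp
  ultimately show "dminus a g z \<noteq> 0"
    using dderiv_eq_pderiv_0[of g, OF p] by (simp add: dminus_def)
qed

lemma tendsto_line:
  assumes "polynomial_fun g"
  shows "((\<lambda>\<eta>::real. g (line z a (\<i> * of_real \<eta>))) \<longlongrightarrow> g z) (at_right 0)"
proof -
  obtain p where p: "\<And>s. g (line z a s) = poly p s"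
    using polynomial_fun_line[OF assms] by blast
  have "g z = poly p (\<i> * of_real 0)" using p[of 0] by simp
  moreover have "((\<lambda>\<eta>::real. poly p (\<i> * of_real \<eta>)) \<longlongrightarrow> poly p (\<i> * of_real 0)) (at_right 0)"
    by (intro tendsto_intros)
  ultimately show ?thesis by (simp add: p)
qed

text \<open>With all imaginary parts positive this is \<open>Im_logderiv_neg\<close>; boundary
  points are reached by shifting every coordinate by \<open>\<i> * \<eta>\<close> and letting \<eta>
  tend to 0.\<close>

lemma Im_dderiv_div_le_0:
  assumes g: "real_stable g" and z: "\<And>v. Im (z v) \<ge> 0" and nz: "g z \<noteq> 0"
    and a: "\<And>v. a v \<ge> 0"
  shows "Im (dderiv a g z / g z) \<le> 0"
proof -
  define w where "w \<eta> = line z (\<lambda>_. 1) (\<i> * of_real \<eta>)" for \<eta> :: real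
  have "((\<lambda>\<eta>. Im (dderiv a g (w \<eta>) / g (w \<eta>))) \<longlongrightarrow> Im (dderiv a g z / g z)) (at_right 0)"
    unfolding w_def using real_stable_poly[OF g] nz
    by (intro tendsto_intros tendsto_line polynomial_fun_dderiv) auto
  moreover have "\<forall>\<^sub>F \<eta> in at_right 0. Im (dderiv a g (w \<eta>) / g (w \<eta>)) \<le> 0"
    unfolding eventually_at_right_field
  proof (intro exI[of _ 1] conjI allI impI)
    fix \<eta> :: real assume \<eta>: "0 < \<eta>" "\<eta> < 1"
    have pos: "Im (w \<eta> v) > 0" for v
      using z[of v] \<eta> by (simp add: w_def line_def add_nonneg_pos)
    obtain p where p: "\<And>s. g (line (w \<eta>) a s) = poly p s"
      using polynomial_fun_line[OF real_stable_poly[OF g]] by blast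
    have "Im (poly (pderiv p) 0 / poly p 0) \<le> 0"
      using Im_logderiv_neg(1) real_stable_line_roots[OF g pos a p] by blast
    then show "Im (dderiv a g (w \<eta>) / g (w \<eta>)) \<le> 0"
      using dderiv_eq_pderiv_0[of g, OF p] p[of 0] by simp
  qed simp
  ultimately show ?thesis
    by (intro tendsto_upperbound) auto
qed

section \<open>Points above the roots and real-rootedness of restrictions\<close>

definition above_roots :: "(('v \<Rightarrow> complex) \<Rightarrow> complex) \<Rightarrow> ('v \<Rightarrow> real) \<Rightarrow> bool" where
  "above_roots g x \<longleftrightarrow> (\<forall>u. (\<forall>v. u v \<ge> 0) \<longrightarrow> g (cvec (\<lambda>v. x v + u v)) \<noteq> 0)"

lemma above_rootsD: "above_roots g x \<Longrightarrow> (\<And>v. u v \<ge> 0) \<Longrightarrow> g (cvec (\<lambda>v. x v + u v)) \<noteq> 0"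
  by (simp add: above_roots_def)

lemma above_roots_nz: "above_roots g x \<Longrightarrow> g (cvec x) \<noteq> 0"
  using above_rootsD[of g x "\<lambda>_. 0"] by simp

lemma above_roots_add:
  assumes "above_roots g x" "\<And>v. u v \<ge> 0"
  shows "above_roots g (\<lambda>v. x v + u v)"
  unfolding above_roots_def
proof (intro allI impI)
  fix u' :: "'a \<Rightarrow> real" assume "\<forall>v. u' v \<ge> 0"
  then show "g (cvec (\<lambda>v. x v + u v + u' v)) \<noteq> 0"
    using above_rootsD[OF assms(1), of "\<lambda>v. u v + u' v"] assms(2) by (simp add: add.assoc)
qed

text \<open>An elementary Hurwitz argument: after shifting by \<open>i\<eta>\<close>, the modulus of the restriction
  increases along vertical half-lines, and this survives \<open>\<eta> \<rightarrow> 0\<close>. Hence a zero in the upper half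
  plane would propagate down to the real axis and force the restriction to vanish.\<close>

lemma line_roots_Im_le_0:
  assumes g: "real_stable g" and nz: "g (cvec x) \<noteq> 0" and a: "\<And>v. a v \<ge> 0"
    and p: "\<And>s. g (line (cvec x) a s) = poly p s" and r: "poly p r = 0"
  shows "Im r \<le> 0"
proof (rule ccontr)
  assume "\<not> Im r \<le> 0"
  then have r_pos: "Im r > 0" by simp
  have mono: "norm (poly p s) \<le> norm (poly p s')"
    if s: "Re s = Re s'" "0 \<le> Im s" "Im s \<le> Im s'" for s s'
  proof (rule tendsto_le[OF trivial_limit_at_right_real])
    let ?w = "\<lambda>\<eta> s. line (line (cvec x) a s) (\<lambda>_. 1) (\<i> * of_real \<eta>)"
    show "((\<lambda>\<eta>. norm (g (?w \<eta> s))) \<longlongrightarrow> norm (poly p s)) (at_right 0)"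
      "((\<lambda>\<eta>. norm (g (?w \<eta> s'))) \<longlongrightarrow> norm (poly p s')) (at_right 0)"
      unfolding p[symmetric] by (intro tendsto_norm tendsto_line real_stable_poly[OF g])+
    show "\<forall>\<^sub>F \<eta> in at_right 0. norm (g (?w \<eta> s)) \<le> norm (g (?w \<eta> s'))"
      unfolding eventually_at_right_field
    proof (intro exI[of _ 1] conjI allI impI)
      fix \<eta> :: real assume \<eta>: "0 < \<eta>" "\<eta> < 1"
      define z where "z = line (cvec x) (\<lambda>_. 1) (\<i> * of_real \<eta>)"
      have z: "Im (z v) > 0" for v using \<eta> by (simp add: z_def line_def cvec_def)
      obtain q where q: "\<And>s. g (line z a s) = poly q s"
        using polynomial_fun_line[OF real_stable_poly[OF g]] by blast
      have "g (?w \<eta> s) = poly q s" for s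
        using q by (simp add: z_def line_commute)
      then show "norm (g (?w \<eta> s)) \<le> norm (g (?w \<eta> s'))"
        using norm_poly_mono_Im[OF real_stable_line_roots(2)[OF g z a q]] s by simp
    qed simp
  qed
  have "(\<lambda>\<tau>. Complex (Re r) \<tau>) ` {0..Im r} \<subseteq> {s. poly p s = 0}"
    using mono[of _ r] r by fastforce
  moreover have "infinite ((\<lambda>\<tau>. Complex (Re r) \<tau>) ` {0..Im r})"
    using r_pos by (subst finite_image_iff) (auto intro: inj_onI)
  ultimately have "infinite {s. poly p s = 0}"
    using finite_subset by blast
  then have "p = 0" using poly_roots_finite by blast
  then show False using p[of 0] nz by simp
qed

text \<open>Nonreal roots come in conjugate pairs, so \<open>line_roots_Im_le_0\<close> makes all
  roots real, and a nonnegative root would be a zero of g in the orthant above x. \<open>L\<close>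
  lists the negated roots with multiplicity.\<close>

lemma line_real_rooted:
  assumes g: "real_stable g" and x: "above_roots g x" and a: "\<And>v. a v \<ge> 0"
    and p: "\<And>s. g (line (cvec x) a s) = poly p s"
  obtains L where "\<And>l. l \<in># L \<Longrightarrow> (0::real) < l" "size L = degree p" "lead_coeff p \<noteq> 0"
    "p = smult (lead_coeff p) (\<Prod>l\<in>#L. [:of_real l, 1:])"
proof
  have nz: "g (cvec x) \<noteq> 0" using above_roots_nz[OF x] .
  then have p0: "p \<noteq> 0" using p[of 0] by auto
  have root: "r = of_real (Re r) \<and> Re r < 0" if r: "poly p r = 0" for r
  proof -
    have "line (cvec x) a (cnj r) = (\<lambda>v. cnj (line (cvec x) a r v))"
      by (simp add: line_def cvec_def)
    then have "poly p (cnj r) = 0"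
      using real_stable_cnj[OF g] r by (metis complex_cnj_zero p)
    then have "Im r = 0"
      using line_roots_Im_le_0[OF g nz a p r] line_roots_Im_le_0[OF g nz a p, of "cnj r"] by simp
    then have r_eq: "r = of_real (Re r)" by (simp add: complex_eq_iff)
    have "Re r < 0"
    proof (rule ccontr)
      assume "\<not> Re r < 0"
      then have "g (cvec (\<lambda>v. x v + Re r * a v)) \<noteq> 0"
        using a by (intro above_rootsD[OF x]) auto
      then show False using r p[of r] r_eq by (metis line_cvec)
    qed
    with r_eq show ?thesis by blast
  qed
  let ?L = "image_mset (\<lambda>r. - Re r) (proots p)"
  show "\<And>l. l \<in># ?L \<Longrightarrow> 0 < l" using root p0 by auto
  show "size ?L = degree p" by (simp add: size_proots_complex)
  show "lead_coeff p \<noteq> 0" using p0 by simp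
  have "(\<Prod>l\<in>#?L. [:of_real l, 1:]) = (\<Prod>r\<in>#proots p. [:- r, 1:])"
  proof -
    have "image_mset (\<lambda>r. [:of_real (- Re r), 1:]) (proots p) = image_mset (\<lambda>r. [:- r, 1:]) (proots p)"
      using root p0 by (intro image_mset_cong) force
    then show ?thesis by (simp add: multiset.map_comp o_def)
  qed
  then show "p = smult (lead_coeff p) (\<Prod>l\<in>#?L. [:of_real l, 1:])"
    by (simp add: complex_poly_decompose_multiset)
qed

lemma poly_prod_mset_pos_linear:
  "poly (\<Prod>l\<in>#L. [:complex_of_real l, 1:]) (of_real s) = of_real (\<Prod>l\<in>#L. s + l)"
  by (induction L) (simp_all add: algebra_simps)

lemma logderiv_prod_mset_pos_linear:
  assumes "\<And>l. l \<in># L \<Longrightarrow> s + l \<noteq> 0" "c \<noteq> 0"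
    and p: "p = smult c (\<Prod>l\<in>#L. [:complex_of_real l, 1:])"
  shows "poly (pderiv p) (of_real s) / poly p (of_real s) = of_real (\<Sum>l\<in>#L. 1 / (s + l))"
proof -
  let ?A = "image_mset (\<lambda>l. - complex_of_real l) L"
  have "complex_of_real s \<notin># ?A"
    using assms(1) by (auto simp: eq_neg_iff_add_eq_0 simp flip: of_real_add)
  from logderiv_prod_mset_linear[OF this assms(2)] p
  have "poly (pderiv p) (of_real s) / poly p (of_real s) = (\<Sum>l\<in>#L. 1 / (of_real s + of_real l))"
    by (simp add: multiset.map_comp o_def)
  also have "\<dots> = of_real (\<Sum>l\<in>#L. 1 / (s + l))"
    by (induction L) auto
  finally show ?thesis .
qed

section \<open>Barrier functions\<close>

text \<open>The derivative of log g in direction \<open>a\<close>. For real stable g the quotient is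
  already real at real points, by \<open>of_real_barrier\<close>; \<open>Re\<close> fixes the
  type.\<close>

definition barrier :: "('v \<Rightarrow> real) \<Rightarrow> (('v \<Rightarrow> complex) \<Rightarrow> complex) \<Rightarrow> ('v \<Rightarrow> real) \<Rightarrow> real" where
  "barrier a g x = Re (dderiv a g (cvec x) / g (cvec x))"

lemma of_real_barrier:
  assumes "real_stable g"
  shows "of_real (barrier a g x) = dderiv a g (cvec x) / g (cvec x)"
proof -
  have "(\<lambda>v. cnj (cvec x v)) = cvec x" by (simp add: cvec_def)
  then have "cnj (dderiv a g (cvec x) / g (cvec x)) = dderiv a g (cvec x) / g (cvec x)"
    using dderiv_cnj[OF assms, of a "cvec x"] real_stable_cnj[OF assms, of "cvec x"] by simp
  then show ?thesis
    unfolding barrier_def by (metis Reals_cnj_iff of_real_Re)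
qed

lemma barrier_line:
  assumes p: "\<And>s. g (line (cvec x) a s) = poly p s"
    and L: "p = smult c (\<Prod>l\<in>#L. [:complex_of_real l, 1:])" "c \<noteq> 0"
    and s: "\<And>l. l \<in># L \<Longrightarrow> s + l \<noteq> 0"
  shows "barrier a g (\<lambda>v. x v + s * a v) = (\<Sum>l\<in>#L. 1 / (s + l))"
  using logderiv_prod_mset_pos_linear[OF s L(2) L(1)] dderiv_eq_pderiv[of g, OF p, of "of_real s"]
    p[of "of_real s"]
  by (simp add: barrier_def line_cvec)

lemma sum_mset_image_nonneg:
  fixes f :: "'a \<Rightarrow> 'b::ordered_comm_monoid_add"
  shows "(\<And>l. l \<in># L \<Longrightarrow> 0 \<le> f l) \<Longrightarrow> 0 \<le> (\<Sum>l\<in>#L. f l)"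
  by (induction L) auto

lemma barrier_nonneg:
  assumes g: "real_stable g" and x: "above_roots g x" and a: "\<And>v. a v \<ge> 0"
  shows "0 \<le> barrier a g x"
proof -
  obtain p where p: "\<And>s. g (line (cvec x) a s) = poly p s"
    using polynomial_fun_line[OF real_stable_poly[OF g]] by blast
  obtain L where L: "\<And>l. l \<in># L \<Longrightarrow> (0::real) < l" "lead_coeff p \<noteq> 0"
    "p = smult (lead_coeff p) (\<Prod>l\<in>#L. [:of_real l, 1:])"
    using line_real_rooted[OF g x a p] by metis
  have "0 + l \<noteq> 0" if "l \<in># L" for l using L(1)[OF that] by simp
  from barrier_line[OF p L(3,2) this] have "barrier a g x = (\<Sum>l\<in>#L. 1 / l)" by simp
  also have "\<dots> \<ge> 0" using L(1) by (intro sum_mset_image_nonneg) (auto intro: less_imp_le)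
  finally show ?thesis .
qed

text \<open>By the Cauchy-Riemann equations Re F' is the vertical derivative of Im F, which starts
  from 0 on the axis and may not become positive above it.\<close>

lemma Re_deriv_le_0_of_Im_le_0:
  assumes F: "(F has_field_derivative F') (at (complex_of_real s))"
    and real: "Im (F (of_real s)) = 0"
    and Im: "\<And>\<tau>. 0 < \<tau> \<Longrightarrow> Im (F (Complex s \<tau>)) \<le> 0"
  shows "Re F' \<le> 0"
proof (rule ccontr)
  assume "\<not> Re F' \<le> 0"
  have "((\<lambda>\<tau>. of_real s + \<i> * complex_of_real \<tau>) has_vector_derivative \<i>) (at 0)"
    by (auto intro!: derivative_eq_intros)
  then have "(F \<circ> (\<lambda>\<tau>. of_real s + \<i> * complex_of_real \<tau>) has_vector_derivative \<i> * F') (at 0)"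
    using F by (intro field_vector_diff_chain_at) auto
  then have "((\<lambda>\<tau>. Im (F (of_real s + \<i> * complex_of_real \<tau>))) has_real_derivative Re F') (at 0)"
    using bounded_linear.has_vector_derivative[OF bounded_linear_Im, of _ "\<i> * F'" "at 0"]
    by (simp add: has_real_derivative_iff_has_vector_derivative o_def)
  moreover have "of_real s + \<i> * complex_of_real \<tau> = Complex s \<tau>" for \<tau>
    by (simp add: complex_eq_iff)
  ultimately have "((\<lambda>\<tau>. Im (F (Complex s \<tau>))) has_real_derivative Re F') (at 0)" by simp
  from DERIV_pos_inc_right[OF this] \<open>\<not> Re F' \<le> 0\<close> obtain d where
    d: "d > 0" "\<And>h. 0 < h \<Longrightarrow> h < d \<Longrightarrow> Im (F (Complex s 0)) < Im (F (Complex s (0 + h)))"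
    by auto
  from d(2)[of "d / 2"] Im[of "d / 2"] real d(1) show False
    by (simp add: complex_of_real_def)
qed

text \<open>Along \<open>u\<close>, the quotient of \<open>dderiv a g\<close> by g is real on the
  real axis and has nonpositive imaginary part in the upper half plane, so its derivative on the
  axis is nonpositive.\<close>

lemma barrier_antimono:
  assumes g: "real_stable g" and x: "above_roots g x"
    and a: "\<And>v. a v \<ge> 0" and u: "\<And>v. u v \<ge> 0"
  shows "barrier a g (\<lambda>v. x v + u v) \<le> barrier a g x"
proof -
  define F where "F s = dderiv a g (line (cvec x) u s) / g (line (cvec x) u s)" for s
  have F_real: "F (of_real s) = of_real (barrier a g (\<lambda>v. x v + s * u v))" for s
    by (simp add: F_def line_cvec of_real_barrier[OF g])
  have deriv: "\<exists>d. ((\<lambda>s. barrier a g (\<lambda>v. x v + s * u v)) has_real_derivative d) (at s) \<and> d \<le> 0"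
    if s: "0 \<le> s" for s
  proof -
    have nz: "g (line (cvec x) u (of_real s)) \<noteq> 0"
      unfolding line_cvec using s u by (intro above_rootsD[OF x]) auto
    note g_deriv = has_field_derivative_line[OF real_stable_poly[OF g], of "cvec x" u "of_real s"]
    note N_deriv = has_field_derivative_line[OF polynomial_fun_dderiv[OF real_stable_poly[OF g]],
        of a "cvec x" u "of_real s"]
    obtain F' where F': "(F has_field_derivative F') (at (of_real s))"
      using DERIV_divide[OF N_deriv g_deriv nz] unfolding F_def[abs_def] by blast
    have "Re F' \<le> 0"
    proof (rule Re_deriv_le_0_of_Im_le_0[OF F'])
      show "Im (F (of_real s)) = 0" by (simp add: F_real)
      show "Im (F (Complex s \<tau>)) \<le> 0" if "\<tau> > 0" for \<tau>
      proof -
        define w where "w = line (cvec x) u (Complex s \<tau>)"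
        have w: "Im (w v) \<ge> 0" for v
          using u[of v] that by (simp add: w_def line_def cvec_def)
        have "Im (dderiv a g w / g w) \<le> 0"
        \<comment> \<open>At a zero of g the quotient is 0, by the convention for division by
          0.\<close>
        proof (cases "g w = 0")
          case False
          show ?thesis by (rule Im_dderiv_div_le_0[OF g]) (fact w False a)+
        qed simp
        then show ?thesis by (simp add: F_def w_def)
      qed
    qed
    moreover have "((\<lambda>s. Re (F (of_real s))) has_real_derivative Re F') (at s)"
    proof -
      have "(complex_of_real has_vector_derivative 1) (at s)"
        by (auto intro!: derivative_eq_intros)
      then have "(F \<circ> complex_of_real has_vector_derivative 1 * F') (at s)"
        using F' by (rule field_vector_diff_chain_at)
      then show ?thesis
        using bounded_linear.has_vector_derivative[OF bounded_linear_Re, of _ "1 * F'" "at s"]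
        by (simp add: has_real_derivative_iff_has_vector_derivative o_def)
    qed
    ultimately show ?thesis unfolding F_real by auto
  qed
  have "barrier a g (\<lambda>v. x v + 1 * u v) \<le> barrier a g (\<lambda>v. x v + 0 * u v)"
    by (rule DERIV_nonpos_imp_nonincreasing[of 0 1]) (use deriv in auto)
  then show ?thesis by simp
qed

text \<open>Barriers decrease upwards, so the bound below 1 at x holds on the whole orthant above x,
  where g and its derivative along \<open>a\<close> can therefore never agree.\<close>

lemma above_roots_dminusI:
  assumes g: "real_stable g" and x: "above_roots g x" and a: "\<And>v. a v \<ge> 0"
    and less: "barrier a g x < 1"
  shows "above_roots (dminus a g) x"
  unfolding above_roots_def
proof (intro allI impI)
  fix u :: "'a \<Rightarrow> real" assume u: "\<forall>v. 0 \<le> u v"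
  let ?y = "\<lambda>v. x v + u v"
  have nz: "g (cvec ?y) \<noteq> 0" using x u by (intro above_rootsD) auto
  have "barrier a g ?y < 1"
    using barrier_antimono[OF g x, of a u] a u less by auto
  then have "dderiv a g (cvec ?y) / g (cvec ?y) \<noteq> 1"
    unfolding of_real_barrier[OF g, symmetric] by (metis less_irrefl of_real_eq_1_iff)
  then show "dminus a g (cvec ?y) \<noteq> 0"
    using nz by (auto simp: dminus_def)
qed

lemma coeff_prod_mset_pos_linear:
  assumes "\<And>l. l \<in># L \<Longrightarrow> (0::real) < l"
  shows "coeff (\<Prod>l\<in>#L. [:complex_of_real l, 1:]) n \<in> \<real>\<^sub>\<ge>\<^sub>0"
    and "coeff (\<Prod>l\<in>#L. [:complex_of_real l, 1:]) 0 = of_real (\<Prod>l\<in>#L. l)"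
proof -
  show "coeff (\<Prod>l\<in>#L. [:complex_of_real l, 1:]) n \<in> \<real>\<^sub>\<ge>\<^sub>0"
    using assms
  proof (induction L arbitrary: n)
    case empty
    then show ?case by (cases n) auto
  next
    case (add l L)
    have "complex_of_real l \<in> \<real>\<^sub>\<ge>\<^sub>0" using add.prems[of l] by (simp add: less_imp_le)
    then show ?case
      using add.IH add.prems
      by (cases n) (auto intro!: nonneg_Reals_add_I nonneg_Reals_mult_I)
  qed
  show "coeff (\<Prod>l\<in>#L. [:complex_of_real l, 1:]) 0 = of_real (\<Prod>l\<in>#L. l)"
    by (induction L) auto
qed

text \<open>If \<open>q = p - p'\<close> has negative roots only, its coefficients have a common sign; solving
  \<open>p\<^sub>n = q\<^sub>n + (n + 1) p\<^sub>n\<^sub>+\<^sub>1\<close> from the top shows the same for \<open>p\<close>.\<close>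

lemma logderiv_less_1_of_diff_pderiv:
  fixes p :: "complex poly"
  assumes eq: "p - pderiv p = smult c (\<Prod>l\<in>#L. [:complex_of_real l, 1:])" and c: "c \<noteq> 0"
    and L: "\<And>l. l \<in># L \<Longrightarrow> 0 < l"
  shows "poly p 0 \<noteq> 0" "Re (poly (pderiv p) 0 / poly p 0) < 1"
proof -
  let ?Q = "\<Prod>l\<in>#L. [:complex_of_real l, 1:]"
  define r where "r = smult (1 / c) p"
  have p: "p = smult c r" using c by (simp add: r_def)
  have rec: "coeff r n = coeff ?Q n + of_nat (Suc n) * coeff r (Suc n)" for n
  proof -
    have "coeff (p - pderiv p) n = c * coeff ?Q n" by (simp add: eq)
    then have "c * coeff r n = c * (coeff ?Q n + of_nat (Suc n) * coeff r (Suc n))"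
      by (simp add: p coeff_pderiv algebra_simps)
    then show ?thesis using c mult_left_cancel by blast
  qed
  have nonneg: "coeff r n \<in> \<real>\<^sub>\<ge>\<^sub>0" if "n + m = Suc (degree r)" for n m
    using that
  proof (induction m arbitrary: n)
    case 0
    then show ?case by (simp add: coeff_eq_0)
  next
    case (Suc m)
    then have "coeff r (Suc n) \<in> \<real>\<^sub>\<ge>\<^sub>0" by simp
    moreover have "complex_of_nat (Suc n) \<in> \<real>\<^sub>\<ge>\<^sub>0" by (simp add: nonneg_Reals_of_nat_I del: of_nat_Suc)
    ultimately show ?case
      using coeff_prod_mset_pos_linear(1)[of L n] L
      by (subst rec) (blast intro!: nonneg_Reals_add_I nonneg_Reals_mult_I)
  qed
  have "coeff r 1 \<in> \<real>\<^sub>\<ge>\<^sub>0" by (cases "degree r") (auto intro!: nonneg simp: coeff_eq_0)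
  then obtain \<beta> where \<beta>: "coeff r 1 = of_real \<beta>" "\<beta> \<ge> 0"
    using nonneg_Reals_cases by blast
  \<comment> \<open>The recursion makes the constant coefficient \<alpha> + \<beta> with \<alpha> >
    0, so the logarithmic derivative at 0 is \<beta> / (\<alpha> + \<beta>) < 1.\<close>
  define \<alpha> where "\<alpha> = (\<Prod>l\<in>#L. l)"
  have \<alpha>: "\<alpha> > 0" unfolding \<alpha>_def using L by (induction L) auto
  have r0: "coeff r 0 = of_real (\<alpha> + \<beta>)"
    using rec[of 0] \<beta> coeff_prod_mset_pos_linear(2)[of L] L by (simp add: \<alpha>_def)
  have ne: "\<alpha> + \<beta> \<noteq> 0" using \<alpha> \<beta>(2) by linarith
  show "poly p 0 \<noteq> 0"
    using c r0 ne by (simp add: p poly_0_coeff_0 del: of_real_add)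
  have "poly (pderiv p) 0 / poly p 0 = of_real (\<beta> / (\<alpha> + \<beta>))"
    using c r0 \<beta>(1) by (simp add: p poly_0_coeff_0 coeff_pderiv del: of_real_add)
  then show "Re (poly (pderiv p) 0 / poly p 0) < 1"
    using \<alpha> \<beta>(2) by (simp del: of_real_add of_real_divide)
qed

text \<open>The converse of \<open>above_roots_dminusI\<close>. Along \<open>a\<close> through any y
  above x, the restriction p - p' has only negative roots, so
  \<open>logderiv_less_1_of_diff_pderiv\<close> applies to p at every such y.\<close>

lemma above_roots_dminusD:
  assumes g: "real_stable g" and a: "\<And>v. a v \<ge> 0" and x: "above_roots (dminus a g) x"
  shows "above_roots g x" "barrier a g x < 1"
proof -
  have *: "g (cvec y) \<noteq> 0 \<and> barrier a g y < 1" if y: "above_roots (dminus a g) y" for y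
  proof -
    obtain p where p: "\<And>s. g (line (cvec y) a s) = poly p s"
      using polynomial_fun_line[OF real_stable_poly[OF g]] by blast
    have q: "dminus a g (line (cvec y) a s) = poly (p - pderiv p) s" for s
      using dderiv_eq_pderiv[of g, OF p] p by (simp add: dminus_def)
    obtain L where L: "\<And>l. l \<in># L \<Longrightarrow> (0::real) < l" "lead_coeff (p - pderiv p) \<noteq> 0"
      "p - pderiv p = smult (lead_coeff (p - pderiv p)) (\<Prod>l\<in>#L. [:of_real l, 1:])"
      using line_real_rooted[OF real_stable_dminus[OF g a] y a q] by metis
    from logderiv_less_1_of_diff_pderiv[OF L(3,2,1)] show ?thesis
      using p[of 0] dderiv_eq_pderiv_0[of g, OF p] by (simp add: barrier_def)
  qed
  show "above_roots g x"
    unfolding above_roots_def using * above_roots_add[OF x] by blast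
  show "barrier a g x < 1" using * x by blast
qed

text \<open>At any y above x the barrier is the sum of 1 / l over the negated roots l, and it is
  below 1. All terms are positive, so every l exceeds 1 and y - a is not a zero.\<close>

lemma above_roots_dminus_shift:
  assumes g: "real_stable g" and a: "\<And>v. a v \<ge> 0" and x: "above_roots (dminus a g) x"
  shows "above_roots g (\<lambda>v. x v - a v)"
  unfolding above_roots_def
proof (intro allI impI)
  fix u :: "'a \<Rightarrow> real" assume "\<forall>v. 0 \<le> u v"
  define y where "y = (\<lambda>v. x v + u v)"
  have "above_roots (dminus a g) y"
    unfolding y_def using x \<open>\<forall>v. 0 \<le> u v\<close> by (intro above_roots_add) auto
  from above_roots_dminusD[OF g a this]
  have y: "above_roots g y" "barrier a g y < 1" by auto
  obtain p where p: "\<And>s. g (line (cvec y) a s) = poly p s"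
    using polynomial_fun_line[OF real_stable_poly[OF g]] by blast
  obtain L where L: "\<And>l. l \<in># L \<Longrightarrow> (0::real) < l" "lead_coeff p \<noteq> 0"
    "p = smult (lead_coeff p) (\<Prod>l\<in>#L. [:of_real l, 1:])"
    using line_real_rooted[OF g y(1) a p] by metis
  have "0 + l \<noteq> 0" if "l \<in># L" for l using L(1)[OF that] by simp
  from barrier_line[OF p L(3,2) this] have sum: "(\<Sum>l\<in>#L. 1 / l) < 1" using y(2) by simp
  have "l > 1" if l: "l \<in># L" for l
  proof -
    obtain L' where L': "L = add_mset l L'" using multi_member_split[OF l] by blast
    have "(\<Sum>l\<in>#L'. 1 / l) \<ge> 0"
      using L(1) L' by (intro sum_mset_image_nonneg) (auto intro: less_imp_le)
    then have "1 / l < 1" using sum L' by simp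
    then show ?thesis using L(1)[OF l] by (simp add: field_simps)
  qed
  then have "(\<Prod>l\<in>#L. - 1 + l) \<noteq> 0" by fastforce
  then have "poly p (of_real (- 1)) \<noteq> 0"
  proof -
    have "poly p (of_real (- 1)) = lead_coeff p * poly (\<Prod>l\<in>#L. [:of_real l, 1:]) (of_real (- 1))"
      by (metis L(3) poly_smult)
    then show ?thesis
      using L(2) \<open>(\<Prod>l\<in>#L. - 1 + l) \<noteq> 0\<close> by (simp only: poly_prod_mset_pos_linear) simp
  qed
  then have "g (cvec (\<lambda>v. y v + (- 1) * a v)) \<noteq> 0"
    unfolding p[symmetric] line_cvec .
  then show "g (cvec (\<lambda>v. x v - a v + u v)) \<noteq> 0"
    by (simp add: y_def algebra_simps)
qed

lemma barrier_lincomb: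
  assumes "polynomial_fun g"
  shows "barrier (\<lambda>v. \<Sum>i\<in>I. p i * e i v) g x = (\<Sum>i\<in>I. p i * barrier (e i) g x)"
proof -
  have "of_real c * w / z = c *\<^sub>R (w / z)" for c and w z :: complex
    by (simp add: scaleR_conv_of_real)
  then show ?thesis
    by (simp add: barrier_def dderiv_lincomb[OF assms] sum_divide_distrib)
qed

text \<open>\<open>above_roots_dminusD\<close> turns the hypothesis into a weighted average of
  barriers below 1; some barrier is then below 1, and \<open>above_roots_dminusI\<close> translates
  back.\<close>

lemma above_roots_dminus_choice:
  assumes g: "real_stable g" and "finite I" and e: "\<And>i v. i \<in> I \<Longrightarrow> e i v \<ge> 0"
    and p: "\<And>i. i \<in> I \<Longrightarrow> p i > 0" "(\<Sum>i\<in>I. p i) = 1"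
    and x: "above_roots (dminus (\<lambda>v. \<Sum>i\<in>I. p i * e i v) g) x"
  obtains i where "i \<in> I" "above_roots (dminus (e i) g) x"
proof -
  have nonneg: "0 \<le> (\<Sum>i\<in>I. p i * e i v)" for v
    using e p(1) by (intro sum_nonneg mult_nonneg_nonneg) (auto intro: less_imp_le)
  from above_roots_dminusD[OF g nonneg x]
  have x': "above_roots g x" and less: "(\<Sum>i\<in>I. p i * barrier (e i) g x) < 1"
    by (simp_all add: barrier_lincomb[OF real_stable_poly[OF g]])
  have "\<exists>i\<in>I. barrier (e i) g x < 1"
  proof (rule ccontr)
    assume "\<not> (\<exists>i\<in>I. barrier (e i) g x < 1)"
    then have "(\<Sum>i\<in>I. p i * 1) \<le> (\<Sum>i\<in>I. p i * barrier (e i) g x)"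
      using p(1) by (intro sum_mono mult_left_mono) (auto intro: less_imp_le)
    with less p(2) show False by simp
  qed
  then show ?thesis
    using that above_roots_dminusI[OF g x'] e by blast
qed

section \<open>Partial fractions of Pick functions\<close>

lemma Im_of_real_mult: "Im (of_real a * z) = a * Im z"
  by simp

text \<open>Near r the quotient behaves like a constant over (s - r)^(m - n). On the ray r + \<rho>
  w, multiplying by the positive number \<rho>^(m - n) keeps the sign of the imaginary part and
  makes the limit finite.\<close>

lemma Im_pole_limit:
  fixes N D N1 D1 :: "complex poly"
  assumes Im: "\<And>s. Im s > 0 \<Longrightarrow> Im (poly N s / poly D s) \<le> 0" and r: "Im r = 0"
    and D: "D = [:- r, 1:] ^ m * D1" "poly D1 r \<noteq> 0"
    and N: "N = [:- r, 1:] ^ n * N1" and "n \<le> m" and w: "Im w > 0"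
  shows "Im (poly N1 r / poly D1 r / w ^ (m - n)) \<le> 0"
proof -
  have w0: "w \<noteq> 0" using w by auto
  let ?f = "\<lambda>\<rho>::real. poly N1 (r + of_real \<rho> * w) / poly D1 (r + of_real \<rho> * w) / w ^ (m - n)"
  have "((\<lambda>\<rho>. Im (?f \<rho>)) \<longlongrightarrow> Im (poly N1 (r + of_real 0 * w) / poly D1 (r + of_real 0 * w) / w ^ (m - n)))
      (at_right 0)"
    using D(2) w0 by (intro tendsto_intros) auto
  moreover have "\<forall>\<^sub>F \<rho> in at_right 0. Im (?f \<rho>) \<le> 0"
    unfolding eventually_at_right_field
  proof (intro exI[of _ 1] conjI allI impI)
    fix \<rho> :: real assume \<rho>: "0 < \<rho>" "\<rho> < 1"
    let ?s = "r + of_real \<rho> * w"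
    let ?v = "of_real \<rho> * w"
    have v0: "?v \<noteq> 0" using \<rho> w0 by simp
    have "poly N ?s / poly D ?s = (?v ^ n * poly N1 ?s) / (?v ^ m * poly D1 ?s)"
      by (simp add: N D(1))
    also have "?v ^ m = ?v ^ n * ?v ^ (m - n)"
      using \<open>n \<le> m\<close> by (simp flip: power_add)
    also have "(?v ^ n * poly N1 ?s) / (?v ^ n * ?v ^ (m - n) * poly D1 ?s) = ?f \<rho> / of_real (\<rho> ^ (m - n))"
      using v0 by (simp add: power_mult_distrib)
    finally have "Im (?f \<rho> / of_real (\<rho> ^ (m - n))) \<le> 0"
      using Im[of ?s] r w \<rho> by (simp only: plus_complex.sel Im_of_real_mult) simp
    moreover have "0 < \<rho> ^ (m - n)" using \<rho> by simp
    ultimately show "Im (?f \<rho>) \<le> 0"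
      unfolding Im_divide_of_real divide_le_0_iff by linarith
  qed simp
  ultimately show ?thesis
    using tendsto_upperbound[of _ _ "at_right (0::real)" 0] by simp
qed

text \<open>As w ranges over the upper half plane, w^j takes every argument strictly between 0 and j
  pi. For j at least 2, the arguments pi/2, 3pi/2, pi and pi/3 together force \<kappa> = 0; for j =
  1 a single w refutes a nonreal \<kappa>.\<close>

lemma pole_order_and_sign:
  fixes \<kappa> :: complex
  assumes \<kappa>: "\<kappa> \<noteq> 0" and j: "j \<ge> 1" and Im: "\<And>w. Im w > 0 \<Longrightarrow> Im (\<kappa> / w ^ j) \<le> 0"
  shows "j = 1" "\<kappa> \<in> \<real>\<^sub>\<ge>\<^sub>0"
proof -
  have rot: "Im \<kappa> * cos t - Re \<kappa> * sin t \<le> 0" if t: "0 < t" "t < j * pi" for t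
  proof -
    have "Im (cis (t / j)) > 0"
      using t j by (auto intro!: sin_gt_zero simp: field_simps)
    then have "Im (\<kappa> / cis (t / j) ^ j) \<le> 0" by (rule Im)
    moreover have "cis (t / j) ^ j = cis t"
      using j by (simp add: Complex.DeMoivre)
    moreover have "\<kappa> / cis t = \<kappa> * cis (- t)"
      by (simp add: divide_inverse)
    ultimately show ?thesis by (simp add: algebra_simps)
  qed
  have half: "pi / 2 < j * pi"
  proof -
    have "1 * pi \<le> j * pi" using j by (intro mult_right_mono) auto
    then show ?thesis using pi_gt_zero by linarith
  qed
  have Re: "Re \<kappa> \<ge> 0" using rot[of "pi / 2"] half by simp
  show "j = 1"
  proof (rule ccontr)
    assume "j \<noteq> 1"
    then have "real j \<ge> 2" using j by simp
    then have j2: "2 * pi \<le> j * pi" by (intro mult_right_mono) auto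
    have "Re \<kappa> \<le> 0"
      using rot[of "3 / 2 * pi"] j2 pi_gt_zero
      unfolding sin_3over2_pi cos_3over2_pi by simp
    moreover have "Im \<kappa> \<ge> 0" using rot[of pi] j2 pi_gt_zero by simp
    moreover have "Im \<kappa> \<le> 0"
      using rot[of "pi / 3"] j2 pi_gt_zero Re \<open>Re \<kappa> \<le> 0\<close> by (simp add: cos_60)
    ultimately show False using \<kappa> Re by (simp add: complex_eq_iff)
  qed
  have "Im \<kappa> = 0"
  proof (rule ccontr)
    assume ne: "Im \<kappa> \<noteq> 0"
    \<comment> \<open>Chosen so that \<open>Im \<kappa> * Re w - Re \<kappa> * Im w\<close>, the
      numerator of \<open>Im (\<kappa> / w)\<close>, equals 1.\<close>
    define w where "w = Complex ((Re \<kappa> + 1) / Im \<kappa>) 1"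
    have "Im (\<kappa> / w) \<le> 0" using Im[of w] \<open>j = 1\<close> by (simp add: w_def)
    moreover have "Im (\<kappa> / w) = 1 / ((Re w)\<^sup>2 + 1)"
      using ne by (simp add: Im_divide w_def)
    moreover have "1 / ((Re w)\<^sup>2 + 1) > 0"
      by (simp add: add_nonneg_pos)
    ultimately show False by simp
  qed
  with Re show "\<kappa> \<in> \<real>\<^sub>\<ge>\<^sub>0" by (simp add: complex_nonneg_Reals_iff)
qed

lemma linear_power_dvd_cancel:
  fixes p q :: "'a::idom poly"
  assumes "[:- r, 1:] ^ k dvd q * p" "poly q r \<noteq> 0"
  shows "[:- r, 1:] ^ k dvd p"
proof (cases "p = 0")
  case False
  moreover have "q \<noteq> 0" using assms(2) by auto
  ultimately show ?thesis
    using assms by (simp add: order_divides order_mult order_0I)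
qed simp

text \<open>The divisibility leaves at most a simple pole at each point of S, so no higher powers of
  1 / (s - r) occur. The induction splits off the residue at one pole at a time.\<close>

lemma partial_fractions:
  fixes D N :: "'a::field poly"
  assumes "finite S" and m: "\<And>r. r \<in> S \<Longrightarrow> m r \<ge> 1"
    and N: "\<And>r. r \<in> S \<Longrightarrow> [:- r, 1:] ^ (m r - 1) dvd N"
  shows "\<exists>Q \<kappa>. \<forall>s. s \<notin> S \<longrightarrow>
    poly N s / poly (\<Prod>r\<in>S. [:- r, 1:] ^ m r) s = poly Q s + (\<Sum>r\<in>S. \<kappa> r / (s - r))"
  using assms
proof (induction S arbitrary: N rule: finite_induct)
  case empty
  show ?case by (rule exI[of _ N]) simp
next
  case (insert r S)
  define D where "D = (\<Prod>r\<in>S. [:- r, 1:] ^ m r)"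
  have D_r: "poly D r \<noteq> 0"
    using insert.hyps by (auto simp: D_def poly_prod)
  obtain N1 where N1: "N = [:- r, 1:] ^ (m r - 1) * N1"
    using insert.prems(2)[of r] by (auto elim: dvdE)
  define \<kappa> where "\<kappa> = poly N1 r / poly D r"
  have "poly (N1 - smult \<kappa> D) r = 0"
    using D_r by (simp add: \<kappa>_def)
  then obtain N2 where N2: "N1 - smult \<kappa> D = [:- r, 1:] * N2"
    unfolding poly_eq_0_iff_dvd by (elim dvdE)
  have "[:- t, 1:] ^ (m t - 1) dvd N2" if t: "t \<in> S" for t
  proof -
    have ne: "t \<noteq> r" using t insert.hyps by auto
    have "[:- t, 1:] ^ (m t - 1) dvd N1"
      by (rule linear_power_dvd_cancel[of t _ "[:- r, 1:] ^ (m r - 1)"])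
        (use insert.prems(2)[of t] t ne N1 in simp_all)
    moreover have "[:- t, 1:] ^ (m t - 1) dvd D"
    proof -
      have "[:- t, 1:] ^ m t dvd D"
        unfolding D_def using t insert.hyps by (intro dvd_prodI) auto
      then show ?thesis by (meson diff_le_self dvd_trans le_imp_power_dvd)
    qed
    ultimately have "[:- t, 1:] ^ (m t - 1) dvd [:- r, 1:] * N2"
      unfolding N2[symmetric] by (intro dvd_diff dvd_smult)
    then show ?thesis
      by (rule linear_power_dvd_cancel) (use ne in simp)
  qed
  then have "\<exists>Q \<kappa>'. \<forall>s. s \<notin> S \<longrightarrow>
      poly N2 s / poly D s = poly Q s + (\<Sum>r\<in>S. \<kappa>' r / (s - r))"
    unfolding D_def using insert.prems(1) by (intro insert.IH) auto
  then obtain Q \<kappa>' where IH: "\<And>s. s \<notin> S \<Longrightarrow>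
      poly N2 s / poly D s = poly Q s + (\<Sum>r\<in>S. \<kappa>' r / (s - r))"
    by blast
  have "poly N s / poly (\<Prod>r\<in>insert r S. [:- r, 1:] ^ m r) s
      = poly Q s + (\<Sum>t\<in>insert r S. (\<kappa>'(r := \<kappa>)) t / (s - t))" if s: "s \<notin> insert r S" for s
  proof -
    have D_s: "poly D s \<noteq> 0" and s_r: "s - r \<noteq> 0"
      using insert.hyps s by (auto simp: D_def poly_prod)
    have "poly (N1 - smult \<kappa> D) s = poly ([:- r, 1:] * N2) s" by (simp only: N2)
    then have N1_s: "poly N1 s = \<kappa> * poly D s + (s - r) * poly N2 s"
      by (simp add: algebra_simps)
    have "m r = Suc (m r - 1)" using insert.prems(1)[of r] by simp
    then have "(s - r) ^ m r = (s - r) ^ (m r - 1) * (s - r)"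
      by (metis power_Suc2)
    then have "poly N s / poly (\<Prod>r\<in>insert r S. [:- r, 1:] ^ m r) s = poly N1 s / ((s - r) * poly D s)"
      using insert.hyps s_r by (simp add: D_def N1 poly_prod)
    also have "\<dots> = \<kappa> / (s - r) + poly N2 s / poly D s"
      unfolding N1_s using D_s s_r by (simp add: add_divide_distrib)
    also have "poly N2 s / poly D s = poly Q s + (\<Sum>r\<in>S. \<kappa>' r / (s - r))"
      using IH s by simp
    also have "(\<Sum>r\<in>S. \<kappa>' r / (s - r)) = (\<Sum>t\<in>S. (\<kappa>'(r := \<kappa>)) t / (s - t))"
      using insert.hyps by (intro sum.cong) auto
    finally show ?thesis using insert.hyps by (simp add: algebra_simps)
  qed
  then show ?case by blast
qed

text \<open>A pole of higher order, or a residue that is not a nonnegative real, would produce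
  values with positive imaginary part in the upper half plane near the pole;
  \<open>pole_order_and_sign\<close> excludes both.\<close>

lemma pick_partial_fractions:
  fixes N D :: "complex poly"
  assumes D: "D \<noteq> 0" and real: "\<And>r. poly D r = 0 \<Longrightarrow> Im r = 0"
    and Im: "\<And>s. Im s > 0 \<Longrightarrow> Im (poly N s / poly D s) \<le> 0"
  shows "\<exists>Q \<kappa>. (\<forall>r. poly D r = 0 \<longrightarrow> 0 \<le> \<kappa> r) \<and> (\<forall>s. poly D s \<noteq> 0 \<longrightarrow>
      poly N s / poly D s = poly Q s + (\<Sum>r | poly D r = 0. complex_of_real (\<kappa> r) / (s - r)))"
proof -
  let ?S = "{r. poly D r = 0}"
  have fin: "finite ?S" using D by (rule poly_roots_finite)
  have m: "order r D \<ge> 1" if "r \<in> ?S" for r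
    using that D by (simp add: order_root Suc_le_eq)
  have dvd: "[:- r, 1:] ^ (order r D - 1) dvd N" if r: "r \<in> ?S" for r
  proof (rule ccontr)
    assume nd: "\<not> [:- r, 1:] ^ (order r D - 1) dvd N"
    then have N: "N \<noteq> 0" and less: "order r N < order r D - 1"
      by (auto simp: order_divides)
    obtain N1 where N1: "N = [:- r, 1:] ^ order r N * N1" "poly N1 r \<noteq> 0"
      using order_decomp[OF N, of r] by (auto simp: poly_eq_0_iff_dvd)
    obtain D1 where D1: "D = [:- r, 1:] ^ order r D * D1" "poly D1 r \<noteq> 0"
      using order_decomp[OF D, of r] by (auto simp: poly_eq_0_iff_dvd)
    have "order r D - order r N = 1"
    proof (rule pole_order_and_sign(1))
      show "poly N1 r / poly D1 r \<noteq> 0" using N1 D1 by simp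
      show "order r D - order r N \<ge> 1" using less by simp
      show "Im (poly N1 r / poly D1 r / w ^ (order r D - order r N)) \<le> 0" if "Im w > 0" for w
        by (rule Im_pole_limit[OF Im _ D1 N1(1) _ that]) (use less real r in auto)
    qed
    then show False using less by simp
  qed
  define D0 where "D0 = (\<Prod>r\<in>?S. [:- r, 1:] ^ order r D)"
  define c where "c = lead_coeff D"
  have c0: "c \<noteq> 0" using D by (simp add: c_def)
  have D_eq: "poly D s = c * poly D0 s" for s
    using complex_poly_decompose[of D] unfolding D0_def c_def by (metis poly_smult)
  obtain Q0 \<kappa>0 where pf: "\<And>s. s \<notin> ?S \<Longrightarrow>
      poly N s / poly D0 s = poly Q0 s + (\<Sum>r\<in>?S. \<kappa>0 r / (s - r))"
    using partial_fractions[OF fin m dvd] unfolding D0_def by blast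
  define Q where "Q = smult (1 / c) Q0"
  define \<kappa>1 where "\<kappa>1 r = \<kappa>0 r / c" for r
  have pf1: "poly N s / poly D s = poly Q s + (\<Sum>r\<in>?S. \<kappa>1 r / (s - r))" if s: "poly D s \<noteq> 0" for s
  proof -
    have "poly N s / poly D s = (poly N s / poly D0 s) / c" by (simp add: D_eq)
    also have "\<dots> = poly Q s + (\<Sum>r\<in>?S. \<kappa>1 r / (s - r))"
      using pf[of s] s by (simp add: Q_def \<kappa>1_def add_divide_distrib sum_divide_distrib mult.commute)
    finally show ?thesis .
  qed
  have pos: "\<kappa>1 r \<in> \<real>\<^sub>\<ge>\<^sub>0" if r: "poly D r = 0" for r
  proof (cases "\<kappa>1 r = 0")
    case False
    show ?thesis
    proof (rule pole_order_and_sign(2)[OF False, of 1])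
      fix w assume w: "Im w > 0"
      have w0: "w \<noteq> 0" using w by auto
      let ?s = "\<lambda>\<rho>::real. r + of_real \<rho> * w"
      \<comment> \<open>\<open>?h \<rho>\<close> is \<rho> times the quotient at
        \<open>?s \<rho>\<close>; in the limit only the contribution \<open>\<kappa>1 r / w\<close>
        of the pole r survives.\<close>
      let ?h = "\<lambda>\<rho>::real. of_real \<rho> * poly Q (?s \<rho>) + (\<kappa>1 r / w
          + of_real \<rho> * (\<Sum>t\<in>?S - {r}. \<kappa>1 t / (?s \<rho> - t)))"
      have "((\<lambda>\<rho>. Im (?h \<rho>)) \<longlongrightarrow> Im (of_real 0 * poly Q (?s 0) + (\<kappa>1 r / w
          + of_real 0 * (\<Sum>t\<in>?S - {r}. \<kappa>1 t / (?s 0 - t))))) (at_right 0)"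
        by (intro tendsto_intros) auto
      moreover have "\<forall>\<^sub>F \<rho> in at_right 0. Im (?h \<rho>) \<le> 0"
        unfolding eventually_at_right_field
      proof (intro exI[of _ 1] conjI allI impI)
        fix \<rho> :: real assume \<rho>: "0 < \<rho>" "\<rho> < 1"
        have Im_s: "Im (?s \<rho>) > 0" using \<rho> w real[OF r] by simp
        then have "poly D (?s \<rho>) \<noteq> 0" using real by force
        from pf1[OF this] have "of_real \<rho> * (poly N (?s \<rho>) / poly D (?s \<rho>)) = ?h \<rho>"
          using \<rho> w0 r fin by (simp add: sum.remove[of ?S r] algebra_simps)
        moreover have "Im (of_real \<rho> * (poly N (?s \<rho>) / poly D (?s \<rho>)))
            = \<rho> * Im (poly N (?s \<rho>) / poly D (?s \<rho>))"
          by (rule Im_of_real_mult)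
        ultimately show "Im (?h \<rho>) \<le> 0"
          using Im[OF Im_s] \<rho> by (metis less_imp_le mult_nonneg_nonpos)
      qed simp
      ultimately have "Im (of_real 0 * poly Q (?s 0) + (\<kappa>1 r / w
          + of_real 0 * (\<Sum>t\<in>?S - {r}. \<kappa>1 t / (?s 0 - t)))) \<le> 0"
        by (rule tendsto_upperbound) simp
      then show "Im (\<kappa>1 r / w ^ 1) \<le> 0" by simp
    qed simp
  qed simp
  have \<kappa>1: "0 \<le> Re (\<kappa>1 r)" "\<kappa>1 r = of_real (Re (\<kappa>1 r))" if "poly D r = 0" for r
    using pos[OF that] by (simp_all add: complex_nonneg_Reals_iff complex_eq_iff)
  have "poly N s / poly D s = poly Q s + (\<Sum>r\<in>?S. of_real (Re (\<kappa>1 r)) / (s - r))"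
    if "poly D s \<noteq> 0" for s
  proof -
    have "(\<Sum>r\<in>?S. \<kappa>1 r / (s - r)) = (\<Sum>r\<in>?S. of_real (Re (\<kappa>1 r)) / (s - r))"
      by (rule sum.cong[OF refl]) (use \<kappa>1(2) in simp)
    then show ?thesis using pf1[OF that] by simp
  qed
  with \<kappa>1(1) show ?thesis
    by (intro exI[of _ Q] exI[of _ "\<lambda>r. Re (\<kappa>1 r)"]) blast
qed

lemma poly_bounded_on_ray_constant:
  fixes Q :: "complex poly"
  assumes "\<And>s::real. 0 \<le> s \<Longrightarrow> norm (poly Q (of_real s)) \<le> B"
  obtains q where "Q = [:q:]"
proof (cases Q)
  case (pCons q p)
  have "p = 0"
  proof (rule ccontr)
    assume "p \<noteq> 0"
    then obtain R where R: "\<And>z. R \<le> norm z \<Longrightarrow> B + 1 \<le> norm (poly (pCons q p) z)"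
      using poly_infinity by blast
    have "B + 1 \<le> norm (poly Q (of_real \<bar>R\<bar>))"
      unfolding pCons by (rule R) simp
    with assms[of "\<bar>R\<bar>"] show False by simp
  qed
  with pCons that show ?thesis by simp
qed


section \<open>Barriers before and after one move\<close>

text \<open>Jensen's inequality for the concave function x / (1 + \<delta> x) at x = 1 / l; the
  right-hand side is the value for K equal terms x = \<phi> / K. The tangent line there has
  nonnegative coefficients, so upper bounds on the number of terms and on their sum are
  enough.\<close>

lemma sum_mset_inverse_shift_le:
  fixes L :: "real multiset"
  assumes L: "\<And>l. l \<in># L \<Longrightarrow> 0 < l" and size: "real (size L) \<le> K" and sum: "(\<Sum>l\<in>#L. 1 / l) \<le> \<phi>"
    and \<delta>: "0 < \<delta>" and K: "0 < K" and \<phi>: "0 \<le> \<phi>"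
  shows "(\<Sum>l\<in>#L. 1 / (\<delta> + l)) \<le> \<phi> / (1 + \<delta> * \<phi> / K)"
proof -
  define u where "u = \<phi> / K"
  define c where "c = 1 + \<delta> * u"
  have u: "u \<ge> 0" using \<phi> K by (simp add: u_def)
  have c: "c > 0" using u \<delta> by (simp add: c_def add_pos_nonneg)
  define A B where "A = 1 / c\<^sup>2" and "B = \<delta> * u\<^sup>2 / c\<^sup>2"
  \<comment> \<open>tangent line of the concave function \<open>x \<mapsto> x / (1 + \<delta> x)\<close> at \<open>u\<close>, evaluated at \<open>x = 1 / l\<close>\<close>
  have tangent: "1 / (\<delta> + l) \<le> A * (1 / l) + B" if l: "l > 0" for l
  proof -
    have "l * c\<^sup>2 \<le> (\<delta> + l) * (1 + l * (\<delta> * u\<^sup>2))"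
    proof -
      have "(\<delta> + l) * (1 + l * (\<delta> * u\<^sup>2)) - l * c\<^sup>2 = \<delta> * (1 - l * u)\<^sup>2"
        by (simp add: c_def power2_eq_square algebra_simps)
      moreover have "\<delta> * (1 - l * u)\<^sup>2 \<ge> 0" using \<delta> by simp
      ultimately show ?thesis by linarith
    qed
    then have "1 / (\<delta> + l) \<le> (1 + l * (\<delta> * u\<^sup>2)) / (l * c\<^sup>2)"
      using l c \<delta> by (simp add: divide_simps mult.commute)
    also have "\<dots> = A * (1 / l) + B"
      using l c by (simp add: A_def B_def field_simps)
    finally show ?thesis .
  qed
  have "(\<Sum>l\<in>#L. 1 / (\<delta> + l)) \<le> A * (\<Sum>l\<in>#L. 1 / l) + B * size L"
    using L
  proof (induction L)
    case (add l L)
    then have "(\<Sum>l\<in>#L. 1 / (\<delta> + l)) \<le> A * (\<Sum>l\<in>#L. 1 / l) + B * size L"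
      by simp
    with tangent[of l] add.prems[of l] show ?case by (simp add: algebra_simps)
  qed simp
  also have "\<dots> \<le> A * \<phi> + B * K"
    using sum size \<delta> by (intro add_mono mult_left_mono) (auto simp: A_def B_def)
  also have "\<dots> = \<phi> / (1 + \<delta> * \<phi> / K)"
  proof -
    have "\<phi> = K * u" using K by (simp add: u_def)
    then have "A * \<phi> + B * K = (K * u + \<delta> * u\<^sup>2 * K) / c\<^sup>2"
      by (simp add: A_def B_def add_divide_distrib)
    also have "K * u + \<delta> * u\<^sup>2 * K = K * (u * c)"
      by (simp add: c_def power2_eq_square algebra_simps)
    finally have "A * \<phi> + B * K = K * (u * c) / c\<^sup>2" .
    also have "\<dots> = K * u / c" using c by (simp add: power2_eq_square)
    finally show ?thesis using K by (simp add: c_def u_def)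
  qed
  finally show ?thesis .
qed

text \<open>\<open>pick_partial_fractions\<close> applies on the line, with poles among the -l. The
  polynomial part is constant: on the ray s \<ge> 0 the barrier lies between 0 and its value at x,
  and the pole terms are bounded too.\<close>

lemma barrier_partial_fractions:
  assumes g: "real_stable g" and x: "above_roots g x" and a: "\<And>v. a v \<ge> 0" and b: "\<And>v. b v \<ge> 0"
    and p: "\<And>s. g (line (cvec x) a s) = poly p s"
    and N: "\<And>s. dderiv b g (line (cvec x) a s) = poly N s"
    and L: "\<And>l. l \<in># L \<Longrightarrow> (0::real) < l"
      "p = smult c (\<Prod>l\<in>#L. [:complex_of_real l, 1:])" "c \<noteq> 0"
  shows "\<exists>q \<kappa>. (\<forall>l. l \<in># L \<longrightarrow> (0::real) \<le> \<kappa> l) \<and> (\<forall>s. poly p s \<noteq> 0 \<longrightarrow>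
      poly N s / poly p s = q + (\<Sum>l\<in>set_mset L. complex_of_real (\<kappa> l) / (s + of_real l)))"
proof -
  have roots: "{r. poly p r = 0} = (\<lambda>l. - complex_of_real l) ` set_mset L"
  proof -
    have "poly p r = c * (\<Prod>l\<in>#L. r + of_real l)" for r
    proof -
      have "poly (\<Prod>l\<in>#M. [:complex_of_real l, 1:]) r = (\<Prod>l\<in>#M. r + of_real l)" for M
        by (induction M) (simp_all add: algebra_simps)
      then show ?thesis by (simp add: L(2))
    qed
    then show ?thesis using L(3) by (auto simp: add_eq_0_iff2)
  qed
  have p0: "p \<noteq> 0" using above_roots_nz[OF x] p[of 0] by auto
  have Im: "Im (poly N s / poly p s) \<le> 0" if s: "Im s > 0" for s
  proof -
    define w where "w = line (cvec x) a s"
    have w: "Im (w v) \<ge> 0" for v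
      using a[of v] s by (simp add: w_def line_def cvec_def)
    have "Im (dderiv b g w / g w) \<le> 0"
    proof (cases "g w = 0")
      case False
      show ?thesis by (rule Im_dderiv_div_le_0[OF g]) (fact w False b)+
    qed simp
    then show ?thesis by (simp add: w_def p N)
  qed
  have real: "Im r = 0" if "poly p r = 0" for r
  proof -
    have "r \<in> (\<lambda>l. - complex_of_real l) ` set_mset L" using that by (simp flip: roots)
    then show ?thesis by auto
  qed
  have "\<exists>Q \<kappa>. (\<forall>r. poly p r = 0 \<longrightarrow> 0 \<le> \<kappa> r) \<and> (\<forall>s. poly p s \<noteq> 0 \<longrightarrow>
      poly N s / poly p s = poly Q s + (\<Sum>r | poly p r = 0. complex_of_real (\<kappa> r) / (s - r)))"
    by (rule pick_partial_fractions[OF p0]) (fact real Im)+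
  then obtain Q \<kappa>0 where \<kappa>0: "\<And>r. poly p r = 0 \<Longrightarrow> (0::real) \<le> \<kappa>0 r"
    and pf: "\<And>s. poly p s \<noteq> 0 \<Longrightarrow>
      poly N s / poly p s = poly Q s + (\<Sum>r | poly p r = 0. complex_of_real (\<kappa>0 r) / (s - r))"
    by blast
  define \<kappa> where "\<kappa> l = \<kappa>0 (- complex_of_real l)" for l
  have \<kappa>: "0 \<le> \<kappa> l" if "l \<in># L" for l
    using \<kappa>0 roots that by (auto simp: \<kappa>_def)
  have pf': "poly N s / poly p s = poly Q s + (\<Sum>l\<in>set_mset L. complex_of_real (\<kappa> l) / (s + of_real l))"
    if "poly p s \<noteq> 0" for s
    unfolding pf[OF that] roots by (subst sum.reindex) (auto simp: inj_on_def \<kappa>_def)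
  have "norm (poly Q (of_real s)) \<le> barrier b g x + (\<Sum>l\<in>set_mset L. \<kappa> l / l)" if s: "0 \<le> s" for s
  proof -
    define y where "y = (\<lambda>v. x v + s * a v)"
    have y: "above_roots g y"
      unfolding y_def using s a by (intro above_roots_add[OF x]) auto
    have "complex_of_real (barrier b g y) = poly N (of_real s) / poly p (of_real s)"
      by (simp add: of_real_barrier[OF g] y_def line_cvec[symmetric] p N)
    moreover have nz: "poly p (of_real s) \<noteq> 0"
      unfolding p[symmetric] line_cvec using y above_roots_nz by (simp add: y_def)
    ultimately have Q: "poly Q (of_real s) = complex_of_real (barrier b g y)
        - (\<Sum>l\<in>set_mset L. complex_of_real (\<kappa> l) / (of_real s + of_real l))"
      using pf'[OF nz] by simp
    have "norm (complex_of_real (barrier b g y)) \<le> barrier b g x"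
    proof -
      have "0 \<le> barrier b g y" by (rule barrier_nonneg[OF g y b])
      moreover have "barrier b g y \<le> barrier b g x"
        unfolding y_def by (rule barrier_antimono[OF g x b]) (use s a in simp)
      ultimately show ?thesis by simp
    qed
    moreover have "norm (\<Sum>l\<in>set_mset L. complex_of_real (\<kappa> l) / (of_real s + of_real l))
        \<le> (\<Sum>l\<in>set_mset L. \<kappa> l / l)"
    proof (rule sum_norm_le)
      fix l assume l: "l \<in> set_mset L"
      have "norm (complex_of_real (\<kappa> l) / (of_real s + of_real l)) = \<kappa> l / (s + l)"
        using L(1)[OF l] \<kappa>[OF l] s by (simp flip: of_real_add of_real_divide)
      also have "\<dots> \<le> \<kappa> l / l"
        using L(1)[OF l] \<kappa>[OF l] s by (intro divide_left_mono) auto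
      finally show "norm (complex_of_real (\<kappa> l) / (of_real s + of_real l)) \<le> \<kappa> l / l" .
    qed
    ultimately show ?thesis
      unfolding Q by (rule order_trans[OF norm_triangle_ineq4 add_mono])
  qed
  then obtain q where "Q = [:q:]" by (rule poly_bounded_on_ray_constant)
  with \<kappa> pf' show ?thesis by (intro exI[of _ q] exI[of _ \<kappa>]) auto
qed

text \<open>The roots of \<open>g\<close> in direction \<open>a\<close> are the poles of the barrier function in direction \<open>b\<close>, so
  the comparison reduces to one inequality per pole \<open>-l\<close>. There \<open>l\<close> itself drops out of the sum
  \<open>\<Sum>1/(\<delta> + l')\<close>, which is why only \<open>k - 1\<close> of the at most \<open>k\<close> roots count.\<close>

lemma barrier_dminus_shift:
  fixes \<phi> \<delta> :: real
  assumes g: "real_stable g" and x: "above_roots g x" and a: "\<And>v. a v \<ge> 0"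
    and deg: "line_degree_le a k g" and k: "k \<ge> 2" and \<delta>: "0 < \<delta>"
    and \<phi>: "barrier a g x \<le> \<phi>" and cond: "\<phi> / (1 + \<delta> * \<phi> / (real k - 1)) \<le> 1 - 1 / \<delta>"
  shows "above_roots (dminus a g) (\<lambda>v. x v + \<delta> * a v)"
    and "(\<And>v. b v \<ge> 0) \<Longrightarrow> barrier b (dminus a g) (\<lambda>v. x v + \<delta> * a v) \<le> barrier b g x"
proof -
  let ?y = "\<lambda>v. x v + \<delta> * a v"
  obtain p where p: "\<And>s. g (line (cvec x) a s) = poly p s"
    using polynomial_fun_line[OF real_stable_poly[OF g]] by blast
  obtain L where L: "\<And>l. l \<in># L \<Longrightarrow> (0::real) < l" "size L = degree p"
    "p = smult (lead_coeff p) (\<Prod>l\<in>#L. [:of_real l, 1:])" "lead_coeff p \<noteq> 0"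
    using line_real_rooted[OF g x a p] by metis
  have size: "size L \<le> k" using line_degree_leD[OF deg p] L(2) by simp
  have bl: "barrier a g (\<lambda>v. x v + s * a v) = (\<Sum>l\<in>#L. 1 / (s + l))" if s: "0 \<le> s" for s
  proof (rule barrier_line[OF p L(3,4)])
    show "s + l \<noteq> 0" if "l \<in># L" for l using L(1)[OF that] s by simp
  qed
  define G where "G = (\<Sum>l\<in>#L. 1 / (\<delta> + l))"
  have Gy: "barrier a g ?y = G" using bl[of \<delta>] \<delta> by (simp add: G_def)
  have \<phi>_sum: "(\<Sum>l\<in>#L. 1 / l) \<le> \<phi>" using bl[of 0] \<phi> by simp
  have \<phi>0: "0 \<le> \<phi>" using barrier_nonneg[OF g x, of a] a \<phi> by force
  have key: "1 / \<delta> - 1 / (\<delta> + l) \<le> 1 - G" if l: "l \<in># L" for l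
  proof -
    obtain M where M: "L = add_mset l M" using multi_member_split[OF l] by blast
    have pos: "0 < l" "\<And>l'. l' \<in># M \<Longrightarrow> 0 < l'" using L(1) M by auto
    have "(\<Sum>l\<in>#M. 1 / (\<delta> + l)) \<le> \<phi> / (1 + \<delta> * \<phi> / (real k - 1))"
    proof (rule sum_mset_inverse_shift_le)
      show "real (size M) \<le> real k - 1" using size M by simp
      show "(\<Sum>l\<in>#M. 1 / l) \<le> \<phi>"
      proof -
        have "0 < 1 / l" using pos(1) by simp
        moreover have "1 / l + (\<Sum>l\<in>#M. 1 / l) \<le> \<phi>" using \<phi>_sum by (simp add: M)
        ultimately show ?thesis by linarith
      qed
    qed (use pos \<delta> k \<phi>0 in auto)
    with cond show ?thesis by (simp add: G_def M)
  qed
  have gap: "0 < 1 / \<delta> - 1 / (\<delta> + l)" if "l \<in># L" for l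
    using L(1)[OF that] \<delta> by (simp add: frac_less2)
  have G1: "G < 1"
  proof (cases "L = {#}")
    case False
    then obtain l where "l \<in># L" by blast
    from key[OF this] gap[OF this] show ?thesis by linarith
  qed (simp add: G_def)
  have y: "above_roots g ?y"
    using \<delta> a by (intro above_roots_add[OF x]) auto
  show "above_roots (dminus a g) ?y"
    by (rule above_roots_dminusI[OF g y a]) (simp add: Gy G1)
  assume b: "\<And>v. b v \<ge> 0"
  obtain N where N: "\<And>s. dderiv b g (line (cvec x) a s) = poly N s"
    using polynomial_fun_line[OF polynomial_fun_dderiv[OF real_stable_poly[OF g]]] by blast
  obtain q \<kappa> where \<kappa>: "\<And>l. l \<in># L \<Longrightarrow> (0::real) \<le> \<kappa> l"
    and pf: "\<And>s. poly p s \<noteq> 0 \<Longrightarrow>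
      poly N s / poly p s = q + (\<Sum>l\<in>set_mset L. complex_of_real (\<kappa> l) / (s + of_real l))"
    using barrier_partial_fractions[where a = a and b = b, OF g x a b p N L(1,3,4)] by fastforce
  let ?d = "complex_of_real \<delta>"
  \<comment> \<open>By the partial fractions, -H is the derivative at \<delta> of the barrier in
    direction \<open>b\<close> along the line.\<close>
  define H where "H = (\<Sum>l\<in>set_mset L. \<kappa> l / (\<delta> + l)\<^sup>2)"
  have p0: "poly p 0 \<noteq> 0" using above_roots_nz[OF x] p[of 0] by simp
  have pd: "poly p ?d \<noteq> 0" using above_roots_nz[OF y] p[of ?d] by (simp add: line_cvec)
  have dl: "\<delta> + l \<noteq> 0" if "l \<in># L" for l using L(1)[OF that] \<delta> by simp
  have deriv: "(poly (pderiv N) ?d * poly p ?d - poly N ?d * poly (pderiv p) ?d) / (poly p ?d)\<^sup>2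
      = - of_real H"
  proof (rule DERIV_unique)
    show "((\<lambda>s. poly N s / poly p s) has_field_derivative
        (poly (pderiv N) ?d * poly p ?d - poly N ?d * poly (pderiv p) ?d) / (poly p ?d)\<^sup>2) (at ?d)"
      using DERIV_divide[OF poly_DERIV[of N ?d] poly_DERIV[of p ?d] pd] by (simp add: power2_eq_square)
    have "((\<lambda>s. q + (\<Sum>l\<in>set_mset L. complex_of_real (\<kappa> l) / (s + of_real l))) has_field_derivative
        (\<Sum>l\<in>set_mset L. - (complex_of_real (\<kappa> l) / (?d + of_real l)\<^sup>2))) (at ?d)"
    proof -
      have "((\<lambda>s. complex_of_real (\<kappa> l) / (s + of_real l)) has_field_derivative
          - (complex_of_real (\<kappa> l) / (?d + of_real l)\<^sup>2)) (at ?d)" if "l \<in> set_mset L" for l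
      proof -
        have "?d + of_real l \<noteq> 0" using dl[OF that] by (simp flip: of_real_add)
        then show ?thesis
          by (auto intro!: derivative_eq_intros simp: power2_eq_square)
      qed
      then have "((\<lambda>s. q + (\<Sum>l\<in>set_mset L. complex_of_real (\<kappa> l) / (s + of_real l))) has_field_derivative
          0 + (\<Sum>l\<in>set_mset L. - (complex_of_real (\<kappa> l) / (?d + of_real l)\<^sup>2))) (at ?d)"
        by (intro DERIV_add DERIV_const DERIV_sum) auto
      then show ?thesis by simp
    qed
    moreover have "(\<Sum>l\<in>set_mset L. - (complex_of_real (\<kappa> l) / (?d + of_real l)\<^sup>2)) = - of_real H"
      by (simp add: H_def sum_negf)
    ultimately show "((\<lambda>s. poly N s / poly p s) has_field_derivative - of_real H) (at ?d)"
    proof (rule_tac has_field_derivative_transform_within_open[of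
          "\<lambda>s. q + (\<Sum>l\<in>set_mset L. complex_of_real (\<kappa> l) / (s + of_real l))"])
      show "open {s. poly p s \<noteq> 0}"
        by (intro open_Collect_neq continuous_intros)
    qed (use pd pf in auto)
  qed
  have y_line: "cvec ?y = line (cvec x) a ?d" by (simp add: line_cvec)
  have logp: "poly (pderiv p) ?d / poly p ?d = of_real G"
    using of_real_barrier[OF g, of a ?y] dderiv_eq_pderiv[of g, OF p] p
    by (simp add: Gy y_line)
  have "of_real (barrier b (dminus a g) ?y) = dderiv b (dminus a g) (cvec ?y) / dminus a g (cvec ?y)"
    by (rule of_real_barrier[OF real_stable_dminus[OF g a]])
  also have "dderiv b (dminus a g) (cvec ?y) = poly N ?d - poly (pderiv N) ?d"
    using real_stable_poly[OF g] dderiv_eq_pderiv[of "dderiv b g", OF N] N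
    by (simp add: dminus_def dderiv_diff polynomial_fun_dderiv dderiv_commute[of g b a] y_line)
  also have "dminus a g (cvec ?y) = poly p ?d - poly (pderiv p) ?d"
    using dderiv_eq_pderiv[of g, OF p] p by (simp add: dminus_def y_line)
  \<comment> \<open>With F = N / p, one has N - N' = F (p - p') - F' p. Dividing by p - p' and using
    F' = -H and p' / p = G at \<delta> gives F + H / (1 - G).\<close>
  also have "(poly N ?d - poly (pderiv N) ?d) / (poly p ?d - poly (pderiv p) ?d)
      = poly N ?d / poly p ?d + of_real (H / (1 - G))"
  proof -
    have p': "poly (pderiv p) ?d = of_real G * poly p ?d"
      using logp pd by (simp add: field_simps)
    have "poly (pderiv N) ?d * poly p ?d - poly N ?d * (of_real G * poly p ?d)
        = - of_real H * (poly p ?d)\<^sup>2"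
      using deriv pd by (simp add: p' divide_eq_eq)
    then have "poly p ?d * (poly (pderiv N) ?d - (of_real G * poly N ?d - of_real H * poly p ?d)) = 0"
      by (simp add: algebra_simps power2_eq_square)
    then have N': "poly (pderiv N) ?d = of_real G * poly N ?d - of_real H * poly p ?d"
      using pd by simp
    have "poly N ?d - poly (pderiv N) ?d = of_real (1 - G) * poly N ?d + of_real H * poly p ?d"
      "poly p ?d - poly (pderiv p) ?d = of_real (1 - G) * poly p ?d"
      unfolding p' N' by (simp_all add: algebra_simps)
    moreover have "complex_of_real (1 - G) \<noteq> 0" using G1 by (simp del: of_real_diff)
    ultimately show ?thesis
      using pd by (simp add: add_divide_distrib del: of_real_diff)
  qed
  finally have barrier_y: "of_real (barrier b (dminus a g) ?y)
      = poly N ?d / poly p ?d + of_real (H / (1 - G))" .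
  have "of_real (barrier b g x) = poly N 0 / poly p 0"
    using of_real_barrier[OF g, of b x] N[of 0] p[of 0] by simp
  then have "complex_of_real (barrier b g x - barrier b (dminus a g) ?y)
      = (\<Sum>l\<in>set_mset L. of_real (\<kappa> l / l)) - (\<Sum>l\<in>set_mset L. of_real (\<kappa> l / (\<delta> + l))) - of_real (H / (1 - G))"
    using pf[OF p0] pf[OF pd] barrier_y by simp
  then have "barrier b g x - barrier b (dminus a g) ?y
      = (\<Sum>l\<in>set_mset L. \<kappa> l / l) - (\<Sum>l\<in>set_mset L. \<kappa> l / (\<delta> + l)) - H / (1 - G)"
    by (simp only: flip: of_real_sum of_real_diff) (simp only: of_real_eq_iff)
  \<comment> \<open>The constant q has cancelled, and since \<kappa> is nonnegative the poles can be
    treated one by one.\<close>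
  also have "\<dots> = (\<Sum>l\<in>set_mset L. \<kappa> l * (1 / l - 1 / (\<delta> + l) - 1 / ((\<delta> + l)\<^sup>2 * (1 - G))))"
    by (simp add: H_def sum_divide_distrib sum_subtractf[symmetric] right_diff_distrib)
  also have "\<dots> \<ge> 0"
  proof (intro sum_nonneg mult_nonneg_nonneg)
    fix l assume l: "l \<in> set_mset L"
    show "0 \<le> \<kappa> l" by (rule \<kappa>[OF l])
    have l0: "0 < l" by (rule L(1)[OF l])
    \<comment> \<open>This is \<open>key\<close>, and it is just what is needed: with 1 - G replaced
      by this lower bound, the expression for the pole -l becomes 0.\<close>
    have "l / (\<delta> * (\<delta> + l)) \<le> 1 - G"
      using key[OF l] l0 \<delta> by (simp add: diff_frac_eq)
    then have "(\<delta> + l)\<^sup>2 * (l / (\<delta> * (\<delta> + l))) \<le> (\<delta> + l)\<^sup>2 * (1 - G)"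
      by (intro mult_left_mono) auto
    then have "1 / ((\<delta> + l)\<^sup>2 * (1 - G)) \<le> 1 / ((\<delta> + l)\<^sup>2 * (l / (\<delta> * (\<delta> + l))))"
      using l0 \<delta> by (intro divide_left_mono) (auto intro!: mult_pos_pos simp: G1)
    also have "\<dots> = 1 / l - 1 / (\<delta> + l)"
    proof -
      have "\<delta> + l \<noteq> 0" using l0 \<delta> by simp
      then have "(\<delta> + l)\<^sup>2 * (l / (\<delta> * (\<delta> + l))) = l * (\<delta> + l) / \<delta>"
        by (simp add: power2_eq_square)
      moreover have "1 / l - 1 / (\<delta> + l) = \<delta> / (l * (\<delta> + l))"
        using l0 \<open>\<delta> + l \<noteq> 0\<close> by (simp add: diff_frac_eq)
      ultimately show ?thesis by simp
    qed
    finally show "0 \<le> 1 / l - 1 / (\<delta> + l) - 1 / ((\<delta> + l)\<^sup>2 * (1 - G))" by simp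
  qed
  finally show "barrier b (dminus a g) ?y \<le> barrier b g x" by simp
qed

section \<open>Selecting outcomes\<close>

lemma real_stable_foldr_dminus:
  "real_stable g \<Longrightarrow> (\<And>a v. a \<in> set as \<Longrightarrow> 0 \<le> a v) \<Longrightarrow> real_stable (foldr dminus as g)"
  by (induction as) (auto intro: real_stable_dminus)

lemma polynomial_fun_foldr_dminus:
  "polynomial_fun g \<Longrightarrow> polynomial_fun (foldr dminus as g)"
  by (induction as) (auto intro: polynomial_fun_dminus)

lemma foldr_dminus_dminus:
  "polynomial_fun g \<Longrightarrow> foldr dminus as (dminus a g) = dminus a (foldr dminus as g)"
  by (induction as) (simp_all add: dminus_commute[of _ a] polynomial_fun_foldr_dminus)

text \<open>Each move leaves the barriers in the remaining directions at most \<phi> and does not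
  raise the degree along them, so the same \<delta> serves at every step.\<close>

lemma above_roots_foldr_dminus:
  fixes \<phi> \<delta> :: real
  assumes "k \<ge> 2" "0 < \<delta>" "\<phi> / (1 + \<delta> * \<phi> / (real k - 1)) \<le> 1 - 1 / \<delta>"
  shows "real_stable g \<Longrightarrow> above_roots g x \<Longrightarrow>
    (\<And>a v. a \<in> set as \<Longrightarrow> 0 \<le> a v) \<Longrightarrow> (\<And>a. a \<in> set as \<Longrightarrow> line_degree_le a k g) \<Longrightarrow>
    (\<And>a. a \<in> set as \<Longrightarrow> barrier a g x \<le> \<phi>) \<Longrightarrow>
    above_roots (foldr dminus as g) (\<lambda>v. x v + \<delta> * (\<Sum>a\<leftarrow>as. a v))"
proof (induction as arbitrary: g x)
  case (Cons a as)
  have a: "0 \<le> a v" and deg: "line_degree_le a k g" and \<phi>: "barrier a g x \<le> \<phi>" for v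
    using Cons.prems by auto
  note shift = barrier_dminus_shift[where a = a, OF Cons.prems(1,2) a deg assms(1,2) \<phi> assms(3)]
  let ?y = "\<lambda>v. x v + \<delta> * a v"
  have "above_roots (foldr dminus as (dminus a g)) (\<lambda>v. ?y v + \<delta> * (\<Sum>a\<leftarrow>as. a v))"
  proof (rule Cons.IH)
    show "real_stable (dminus a g)" by (rule real_stable_dminus[OF Cons.prems(1) a])
    show "above_roots (dminus a g) ?y" by (rule shift(1))
    show "0 \<le> b v" if "b \<in> set as" for b v using Cons.prems(3) that by simp
    show "line_degree_le b k (dminus a g)" if "b \<in> set as" for b
      using Cons.prems(4) that by (intro line_degree_le_dminus real_stable_poly Cons.prems(1)) simp
    show "barrier b (dminus a g) ?y \<le> \<phi>" if b: "b \<in> set as" for b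
    proof -
      have "barrier b (dminus a g) ?y \<le> barrier b g x"
        using Cons.prems(3) b by (intro shift(2)) simp
      also have "\<dots> \<le> \<phi>" using Cons.prems(5) b by simp
      finally show ?thesis .
    qed
  qed
  then show ?case
    using Cons.prems(1) by (simp add: foldr_dminus_dminus real_stable_poly algebra_simps)
qed simp

text \<open>A choice is made for the outermost mean. Because the operators commute, the chosen one
  can then be moved innermost and absorbed into g for the induction.\<close>

lemma above_roots_foldr_dminus_choice:
  assumes fin: "\<And>i. finite (S i)" and e: "\<And>i w v. w \<in> S i \<Longrightarrow> 0 \<le> e i w v"
    and p: "\<And>i w. w \<in> S i \<Longrightarrow> 0 < p i w"
  shows "real_stable g \<Longrightarrow> distinct is \<Longrightarrow> (\<And>i. i \<in> set is \<Longrightarrow> (\<Sum>w\<in>S i. p i w) = (1::real)) \<Longrightarrow>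
    above_roots (foldr dminus (map (\<lambda>i v. \<Sum>w\<in>S i. p i w * e i w v) is) g) x \<Longrightarrow>
    \<exists>f. (\<forall>i\<in>set is. f i \<in> S i) \<and> above_roots (foldr dminus (map (\<lambda>i. e i (f i)) is) g) x"
proof (induction "is" arbitrary: g)
  case (Cons i "is")
  let ?d = "\<lambda>i v. \<Sum>w\<in>S i. p i w * e i w v"
  have d: "0 \<le> ?d i v" for i v
    using e p by (intro sum_nonneg mult_nonneg_nonneg) (auto intro: less_imp_le)
  have "real_stable (foldr dminus (map ?d is) g)"
    using d by (intro real_stable_foldr_dminus Cons.prems(1)) auto
  moreover have "above_roots (dminus (?d i) (foldr dminus (map ?d is) g)) x"
    using Cons.prems(4) by simp
  ultimately obtain w where w: "w \<in> S i"
    and "above_roots (dminus (e i w) (foldr dminus (map ?d is) g)) x"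
    using above_roots_dminus_choice[of "foldr dminus (map ?d is) g" "S i" "e i" "p i" x]
      fin e p Cons.prems(3)[of i] by auto
  then have "above_roots (foldr dminus (map ?d is) (dminus (e i w) g)) x"
    by (simp add: foldr_dminus_dminus real_stable_poly[OF Cons.prems(1)])
  moreover have "real_stable (dminus (e i w) g)"
    using e[OF w] by (intro real_stable_dminus Cons.prems(1))
  ultimately obtain f where f: "\<forall>i\<in>set is. f i \<in> S i"
    "above_roots (foldr dminus (map (\<lambda>i. e i (f i)) is) (dminus (e i w) g)) x"
    using Cons.IH[of "dminus (e i w) g"] Cons.prems(2,3) by auto
  have "map (\<lambda>j. e j ((f(i := w)) j)) is = map (\<lambda>j. e j (f j)) is"
    using Cons.prems(2) by auto
  then have "foldr dminus (map (\<lambda>j. e j ((f(i := w)) j)) (i # is)) g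
      = dminus (e i w) (foldr dminus (map (\<lambda>j. e j (f j)) is) g)"
    by (simp only: list.map foldr_Cons o_apply fun_upd_same)
  then have "above_roots (foldr dminus (map (\<lambda>j. e j ((f(i := w)) j)) (i # is)) g) x"
    using f(2) by (simp only: foldr_dminus_dminus real_stable_poly[OF Cons.prems(1)])
  moreover have "\<forall>j\<in>set (i # is). (f(i := w)) j \<in> S j"
    using f(1) w by auto
  ultimately show ?case by blast
qed simp

lemma above_roots_foldr_dminus_shift:
  "real_stable g \<Longrightarrow> (\<And>c v. c \<in> set cs \<Longrightarrow> 0 \<le> c v) \<Longrightarrow> above_roots (foldr dminus cs g) x \<Longrightarrow>
    above_roots g (\<lambda>v. x v - (\<Sum>c\<leftarrow>cs. c v))"
proof (induction cs arbitrary: x)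
  case (Cons c cs)
  have "above_roots (foldr dminus cs g) (\<lambda>v. x v - c v)"
  proof (rule above_roots_dminus_shift)
    show "real_stable (foldr dminus cs g)"
      using Cons.prems by (intro real_stable_foldr_dminus) auto
  qed (use Cons.prems in auto)
  then have "above_roots g (\<lambda>v. x v - c v - (\<Sum>c\<leftarrow>cs. c v))"
    using Cons.prems by (intro Cons.IH) auto
  then show ?case by (simp add: algebra_simps)
qed simp

text \<open>This replaces the interlacing argument: the logarithmic derivative at a fixed point is linear
  in the direction, so averaging selects outcomes while the point stays above all roots.\<close>

theorem above_roots_selection:
  fixes \<phi> \<delta> t :: real and m :: nat
  assumes h: "real_stable h" and fin: "\<And>i. finite (S i)"
    and e: "\<And>i w v. w \<in> S i \<Longrightarrow> 0 \<le> e i w v" and p: "\<And>i w. w \<in> S i \<Longrightarrow> 0 < p i w"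
    and p1: "\<And>i. i \<in> {1..m} \<Longrightarrow> (\<Sum>w\<in>S i. p i w) = 1"
    and a: "\<And>i. a i = (\<lambda>v. \<Sum>w\<in>S i. p i w * e i w v)"
    and deg: "\<And>i. i \<in> {1..m} \<Longrightarrow> line_degree_le (a i) k h"
    and x: "above_roots h (\<lambda>v. t * (\<Sum>i=1..m. a i v))"
    and \<phi>: "\<And>i. i \<in> {1..m} \<Longrightarrow> barrier (a i) h (\<lambda>v. t * (\<Sum>i=1..m. a i v)) \<le> \<phi>"
    and k: "k \<ge> 2" and \<delta>: "0 < \<delta>" and cond: "\<phi> / (1 + \<delta> * \<phi> / (real k - 1)) \<le> 1 - 1 / \<delta>"
  obtains f where "\<And>i. i \<in> {1..m} \<Longrightarrow> f i \<in> S i"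
    "above_roots h (\<lambda>v. (t + \<delta>) * (\<Sum>i=1..m. a i v) - (\<Sum>i=1..m. e i (f i) v))"
proof -
  define xs where "xs = [1..<Suc m]"
  have xs: "set xs = {1..m}" "distinct xs" by (auto simp: xs_def)
  have sum_xs: "(\<Sum>i\<leftarrow>xs. c i) = (\<Sum>i=1..m. c i)" for c :: "nat \<Rightarrow> real"
    using sum_list_distinct_conv_sum_set[OF xs(2), of c] xs(1) by simp
  have a_nonneg: "0 \<le> a i v" for i v
    unfolding a using e p by (intro sum_nonneg mult_nonneg_nonneg) (auto intro: less_imp_le)
  let ?x = "\<lambda>v. t * (\<Sum>i=1..m. a i v)"
  have "above_roots (foldr dminus (map a xs) h) (\<lambda>v. ?x v + \<delta> * (\<Sum>a\<leftarrow>map a xs. a v))"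
    using a_nonneg deg \<phi> xs(1)
    by (intro above_roots_foldr_dminus[OF k \<delta> cond h x]) auto
  moreover have "(\<lambda>v. ?x v + \<delta> * (\<Sum>a\<leftarrow>map a xs. a v)) = (\<lambda>v. (t + \<delta>) * (\<Sum>i=1..m. a i v))"
    using sum_xs by (simp add: o_def algebra_simps)
  moreover have "map a xs = map (\<lambda>i v. \<Sum>w\<in>S i. p i w * e i w v) xs"
    by (simp add: a)
  ultimately have "above_roots (foldr dminus (map (\<lambda>i v. \<Sum>w\<in>S i. p i w * e i w v) xs) h)
      (\<lambda>v. (t + \<delta>) * (\<Sum>i=1..m. a i v))"
    by simp
  moreover have "\<exists>f. (\<forall>i\<in>set xs. f i \<in> S i) \<and>
      above_roots (foldr dminus (map (\<lambda>i. e i (f i)) xs) h) (\<lambda>v. (t + \<delta>) * (\<Sum>i=1..m. a i v))"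
    if "above_roots (foldr dminus (map (\<lambda>i v. \<Sum>w\<in>S i. p i w * e i w v) xs) h)
      (\<lambda>v. (t + \<delta>) * (\<Sum>i=1..m. a i v))"
    by (rule above_roots_foldr_dminus_choice[where p = p])
      (use fin e p h xs p1 that in auto)
  ultimately obtain f where f: "\<forall>i\<in>{1..m}. f i \<in> S i"
    "above_roots (foldr dminus (map (\<lambda>i. e i (f i)) xs) h) (\<lambda>v. (t + \<delta>) * (\<Sum>i=1..m. a i v))"
    unfolding xs(1) by blast
  have "above_roots h (\<lambda>v. (t + \<delta>) * (\<Sum>i=1..m. a i v) - (\<Sum>c\<leftarrow>map (\<lambda>i. e i (f i)) xs. c v))"
    by (rule above_roots_foldr_dminus_shift[OF h _ f(2)]) (use e f(1) xs(1) in auto)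
  then have "above_roots h (\<lambda>v. (t + \<delta>) * (\<Sum>i=1..m. a i v) - (\<Sum>i=1..m. e i (f i) v))"
    using sum_xs by (simp add: o_def)
  with f(1) that show ?thesis by blast
qed

section \<open>Determinantal pencils\<close>

definition pencil :: "'v set \<Rightarrow> ('v \<Rightarrow> complex^'d^'d) \<Rightarrow> ('v \<Rightarrow> complex) \<Rightarrow> complex^'d^'d" where
  "pencil I B z = (\<chi> i j. \<Sum>v\<in>I. z v * B v $ i $ j)"

definition cform :: "complex^'d^'d \<Rightarrow> complex^'d \<Rightarrow> complex" where
  "cform A x = (\<Sum>i\<in>UNIV. cnj (x $ i) * (A *v x) $ i)"

text \<open>The inner product on \<open>complex^'d\<close> is the real part of the Hermitian
  one.\<close>

lemma Re_cform: "Re (cform A x) = x \<bullet> (A *v x)"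
  by (simp add: cform_def inner_vec_def inner_complex_def)

lemma cform_eq: "cform A x = (\<Sum>i\<in>UNIV. \<Sum>j\<in>UNIV. cnj (x $ i) * A $ i $ j * x $ j)"
  by (simp add: cform_def matrix_vector_mult_def sum_distrib_left mult.assoc)

lemma Im_cform:
  assumes "hermitian A"
  shows "Im (cform A x) = 0"
proof -
  have "cnj (cform A x) = (\<Sum>i\<in>UNIV. \<Sum>j\<in>UNIV. x $ i * cnj (A $ i $ j) * cnj (x $ j))"
    by (simp add: cform_eq)
  also have "\<dots> = (\<Sum>j\<in>UNIV. \<Sum>i\<in>UNIV. x $ i * cnj (A $ i $ j) * cnj (x $ j))"
    by (rule sum.swap)
  also have "\<dots> = cform A x"
    unfolding cform_eq using assms
    by (intro sum.cong refl) (metis (no_types, lifting) hermitian_def mult.assoc mult.commute)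
  finally show ?thesis by (simp add: complex_eq_iff)
qed

lemma cform_pencil: "cform (pencil I B z) x = (\<Sum>v\<in>I. z v * cform (B v) x)"
proof -
  have "cform (pencil I B z) x = (\<Sum>i\<in>UNIV. \<Sum>j\<in>UNIV. \<Sum>v\<in>I. z v * (cnj (x $ i) * B v $ i $ j * x $ j))"
    by (simp add: cform_eq pencil_def sum_distrib_left sum_distrib_right algebra_simps)
  also have "\<dots> = (\<Sum>i\<in>UNIV. \<Sum>v\<in>I. \<Sum>j\<in>UNIV. z v * (cnj (x $ i) * B v $ i $ j * x $ j))"
    by (intro sum.cong refl sum.swap)
  also have "\<dots> = (\<Sum>v\<in>I. \<Sum>i\<in>UNIV. \<Sum>j\<in>UNIV. z v * (cnj (x $ i) * B v $ i $ j * x $ j))"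
    by (rule sum.swap)
  also have "\<dots> = (\<Sum>v\<in>I. z v * cform (B v) x)"
    by (simp add: cform_eq sum_distrib_left)
  finally show ?thesis .
qed

lemma cform_mat: "cform (mat c) x = c * of_real ((norm x)\<^sup>2)"
proof -
  have "cform (mat c) x = (\<Sum>i\<in>UNIV. c * (cnj (x $ i) * x $ i))"
    unfolding cform_eq by (simp add: mat_def if_distrib if_distribR sum.delta' cong: if_cong)
      (simp add: algebra_simps)
  also have "\<dots> = c * (\<Sum>i\<in>UNIV. of_real ((norm (x $ i))\<^sup>2))"
    unfolding sum_distrib_left by (simp only: complex_norm_square mult.commute)
  finally show ?thesis
    by (simp add: norm_vec_def L2_set_def sum_nonneg)
qed

lemma det_eq_0_kernel:
  fixes A :: "'a::field^'n^'n"
  assumes "det A = 0"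
  obtains x where "x \<noteq> 0" "A *v x = 0"
  using assms by (metis invertible_det_nz invertible_left_inverse matrix_left_invertible_ker)

lemma polynomial_fun_det_pencil: "polynomial_fun (\<lambda>z. det (pencil I B z))"
  unfolding det_def pencil_def
  by (simp, intro polynomial_fun_sum polynomial_fun.mult polynomial_fun_prod polynomial_fun.const
      polynomial_fun.var)

lemma det_cnj: "det (\<chi> i j. cnj (A $ i $ j)) = cnj (det A)"
  by (simp add: det_def)

text \<open>For a kernel vector x, the imaginary part of its quadratic form is a sum of nonnegative
  terms \<open>Im (z v) * Re (cform (B v) x)\<close> equal to 0. So every
  \<open>cform (B v) x\<close> vanishes, while their combination with weights p is the squared norm
  of x.\<close>

lemma real_stable_det_pencil:
  fixes B :: "'v \<Rightarrow> complex^'d^'d"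
  assumes "finite I" and psd: "\<And>v. v \<in> I \<Longrightarrow> pos_semidef (B v)"
    and p: "\<And>v. v \<in> I \<Longrightarrow> 0 \<le> p v" and one: "pencil I B (cvec p) = mat 1"
  shows "real_stable (\<lambda>z. det (pencil I B z))"
  unfolding real_stable_def
proof (intro conjI allI impI polynomial_fun_det_pencil)
  show "det (pencil I B (\<lambda>v. cnj (z v))) = cnj (det (pencil I B z))" for z
  proof -
    have "B v $ i $ j = cnj (B v $ j $ i)" if "v \<in> I" for v i j
      using psd[OF that] unfolding pos_semidef_def hermitian_def by blast
    then have "pencil I B (\<lambda>v. cnj (z v)) $ i $ j = cnj (pencil I B z $ j $ i)" for i j
      unfolding pencil_def vec_lambda_beta cnj_sum complex_cnj_mult
      by (intro sum.cong refl arg_cong[where f = "(*) _"])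
    then have "pencil I B (\<lambda>v. cnj (z v)) = transpose (\<chi> i j. cnj (pencil I B z $ i $ j))"
      by (simp add: transpose_def vec_eq_iff)
    then show ?thesis by (simp add: det_cnj)
  qed
  fix z :: "'v \<Rightarrow> complex" assume z: "\<forall>v. 0 < Im (z v)"
  show "det (pencil I B z) \<noteq> 0"
  proof
    assume "det (pencil I B z) = 0"
    then obtain x where x: "x \<noteq> 0" "pencil I B z *v x = 0" by (rule det_eq_0_kernel)
    have Re: "0 \<le> Re (cform (B v) x)" and Im: "Im (cform (B v) x) = 0" if "v \<in> I" for v
      using psd[OF that] Im_cform by (auto simp: pos_semidef_def cform_def)
    have "cform (pencil I B z) x = 0" using x(2) by (simp add: cform_def)
    then have "Im (\<Sum>v\<in>I. z v * cform (B v) x) = 0" by (simp add: cform_pencil)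
    then have "(\<Sum>v\<in>I. Im (z v) * Re (cform (B v) x)) = 0" using Im by simp
    moreover have "0 \<le> Im (z v) * Re (cform (B v) x)" if "v \<in> I" for v
      using z Re[OF that] by (simp add: less_imp_le)
    ultimately have "\<forall>v\<in>I. Im (z v) * Re (cform (B v) x) = 0"
      using sum_nonneg_eq_0_iff[OF \<open>finite I\<close>, of "\<lambda>v. Im (z v) * Re (cform (B v) x)"] by simp
    then have "cform (B v) x = 0" if "v \<in> I" for v
      using z Im[OF that] that by (metis complex_eqI less_irrefl mult_eq_0_iff zero_complex.sel)
    then have "cform (pencil I B (cvec p)) x = 0" by (simp add: cform_pencil)
    then show False using x(1) by (simp add: one cform_mat)
  qed
qed

text \<open>At such points the quadratic form is at least t times the squared norm, so there is no
  kernel.\<close>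

lemma above_roots_det_pencil:
  fixes B :: "'v \<Rightarrow> complex^'d^'d"
  assumes psd: "\<And>v. v \<in> I \<Longrightarrow> pos_semidef (B v)"
    and one: "pencil I B (cvec p) = mat 1" and t: "0 < t"
  shows "above_roots (\<lambda>z. det (pencil I B z)) (\<lambda>v. t * p v)"
  unfolding above_roots_def
proof (intro allI impI notI)
  fix u :: "'v \<Rightarrow> real" assume u: "\<forall>v. 0 \<le> u v"
  assume "det (pencil I B (cvec (\<lambda>v. t * p v + u v))) = 0"
  then obtain x where x: "x \<noteq> 0" "pencil I B (cvec (\<lambda>v. t * p v + u v)) *v x = 0"
    by (rule det_eq_0_kernel)
  have "0 = cform (pencil I B (cvec (\<lambda>v. t * p v + u v))) x"
    using x(2) by (simp add: cform_def)
  also have "\<dots> = of_real t * cform (pencil I B (cvec p)) x + (\<Sum>v\<in>I. of_real (u v) * cform (B v) x)"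
    by (simp add: cform_pencil cvec_def sum_distrib_left sum.distrib algebra_simps)
  finally have "0 = Re (of_real t * of_real ((norm x)\<^sup>2) + (\<Sum>v\<in>I. of_real (u v) * cform (B v) x))"
    by (simp add: one cform_mat)
  then have "0 = t * (norm x)\<^sup>2 + (\<Sum>v\<in>I. u v * Re (cform (B v) x))"
    by simp
  moreover have "0 < t * (norm x)\<^sup>2" using t x(1) by simp
  moreover have "0 \<le> (\<Sum>v\<in>I. u v * Re (cform (B v) x))"
    using u psd by (intro sum_nonneg mult_nonneg_nonneg) (auto simp: pos_semidef_def cform_def)
  ultimately show False by linarith
qed

section \<open>Degree and logarithmic derivative of the determinant along a line\<close>

lemma matrix_diff_rdistrib: "(A - B) ** C = A ** C - B ** C" for A B :: "'a::ring_1^'n^'m"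
  by (simp add: matrix_matrix_mult_def vec_eq_iff sum_subtractf left_diff_distrib)

text \<open>Choose rows R of A forming a basis of its row space and subtract their combinations from
  the other rows by the invertible matrix P = 1 - C, where C squares to 0. Then P A is zero outside
  R, so s occurs in only rank A rows of the Leibniz expansion.\<close>

lemma det_degree_le_rank:
  fixes A Z :: "'a::field^'n^'n"
  obtains p where "degree p \<le> rank A" "\<And>s. det (\<chi> i j. Z $ i $ j + s * A $ i $ j) = poly p s"
proof -
  obtain Bs where Bs: "Bs \<subseteq> rows A" "vec.independent Bs" "rows A \<subseteq> vec.span Bs" "card Bs = vec.dim (rows A)"
    using vec.basis_exists by blast
  have fin: "finite Bs"
    using Bs(1) by (rule finite_subset) (simp add: rows_def full_SetCompr_eq)
  have "\<forall>b\<in>Bs. \<exists>i. row i A = b" using Bs(1) by (auto simp: rows_def)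
  then obtain idx where idx: "\<And>b. b \<in> Bs \<Longrightarrow> row (idx b) A = b" by metis
  have inj: "inj_on idx Bs" by (rule inj_onI) (metis idx)
  define R where "R = idx ` Bs"
  have card_R: "card R = rank A"
    using Bs(4) by (simp add: R_def card_image[OF inj] row_rank_def_gen)
  have "\<forall>i. \<exists>u. row i A = (\<Sum>b\<in>Bs. u b *s b)"
    using Bs(3) vec.span_finite[OF fin] by (auto simp: rows_def)
  then obtain u where u: "\<And>i. row i A = (\<Sum>b\<in>Bs. u i b *s b)" by metis
  define c where "c i r = u i (row r A)" for i r
  have c: "A $ i $ j = (\<Sum>r\<in>R. c i r * A $ r $ j)" for i j
  proof -
    have "row i A $ j = (\<Sum>b\<in>Bs. u i b * b $ j)" by (subst u) simp
    also have "\<dots> = (\<Sum>r\<in>R. c i r * A $ r $ j)"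
      unfolding R_def sum.reindex[OF inj] c_def
    proof (intro sum.cong refl)
      fix b assume "b \<in> Bs"
      then show "u i b * b $ j = ((\<lambda>r. u i (row r A) * A $ r $ j) \<circ> idx) b"
        using idx[of b] by (metis comp_apply row_def vec_lambda_eta)
    qed
    finally show ?thesis by (simp add: row_def)
  qed
  define C :: "'a^'n^'n" where "C = (\<chi> i r. if i \<notin> R \<and> r \<in> R then c i r else 0)"
  have CC: "C ** C = 0"
    by (auto simp: C_def matrix_matrix_mult_def vec_eq_iff intro!: sum.neutral)
  have "(mat 1 - C) ** (mat 1 + C) = mat 1"
    by (simp add: matrix_diff_rdistrib matrix_add_ldistrib CC)
  then have "det (mat 1 - C) * det (mat 1 + C) = 1" by (metis det_I det_mul)
  then have det_ne: "det (mat 1 - C) \<noteq> 0" by auto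
  define P where "P = mat 1 - C"
  have PA: "(P ** A) $ i $ j = 0" if i: "i \<notin> R" for i j
  proof -
    have "(C ** A) $ i $ j = (\<Sum>r\<in>UNIV. if r \<in> R then c i r * A $ r $ j else 0)"
      using i by (auto simp: C_def matrix_matrix_mult_def intro!: sum.cong)
    also have "\<dots> = A $ i $ j" by (subst c) (simp add: sum.If_cases)
    finally show ?thesis by (simp add: P_def matrix_diff_rdistrib)
  qed
  define q where "q = (\<Sum>\<sigma> | \<sigma> permutes UNIV. smult (of_int (sign \<sigma>))
      (\<Prod>i\<in>UNIV. [:(P ** Z) $ i $ \<sigma> i, (P ** A) $ i $ \<sigma> i:]))"
  have deg: "degree q \<le> rank A"
    unfolding q_def
  proof (intro degree_sum_le)
    fix \<sigma> :: "'n \<Rightarrow> 'n"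
    let ?f = "\<lambda>i. [:(P ** Z) $ i $ \<sigma> i, (P ** A) $ i $ \<sigma> i:]"
    have "degree (\<Prod>i\<in>UNIV. ?f i) \<le> (\<Sum>i\<in>UNIV. degree (?f i))"
      using degree_prod_sum_le[of UNIV ?f] by simp
    also have "\<dots> \<le> (\<Sum>i\<in>UNIV. if i \<in> R then 1 else 0)"
      by (intro sum_mono) (auto simp: PA)
    also have "\<dots> = rank A" by (simp add: card_R sum.If_cases)
    finally show "degree (smult (of_int (sign \<sigma>)) (\<Prod>i\<in>UNIV. ?f i)) \<le> rank A"
      using degree_smult_le order_trans by blast
  qed simp
  have "det P * det (\<chi> i j. Z $ i $ j + s * A $ i $ j) = poly q s" for s
  proof -
    have "(P ** (\<chi> i j. Z $ i $ j + s * A $ i $ j)) $ i $ j = (P ** Z) $ i $ j + s * (P ** A) $ i $ j" for i j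
      by (simp add: matrix_matrix_mult_def sum.distrib sum_distrib_left algebra_simps)
    then have "det (P ** (\<chi> i j. Z $ i $ j + s * A $ i $ j)) = poly q s"
      by (simp add: det_def q_def poly_sum poly_prod algebra_simps)
    then show ?thesis by (simp add: det_mul)
  qed
  then have "det (\<chi> i j. Z $ i $ j + s * A $ i $ j) = poly (smult (1 / det P) q) s" for s
    using det_ne by (simp add: P_def eq_divide_eq mult.commute)
  moreover have "degree (smult (1 / det P) q) \<le> rank A"
    using deg degree_smult_le order_trans by blast
  ultimately show ?thesis using that by blast
qed

lemma pencil_line:
  "pencil I B (line z a s) = (\<chi> i j. pencil I B z $ i $ j + s * pencil I B (cvec a) $ i $ j)"
  by (simp add: pencil_def line_def cvec_def sum.distrib sum_distrib_left algebra_simps)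

lemma line_degree_le_det_pencil:
  assumes "rank (pencil I B (cvec a)) \<le> k"
  shows "line_degree_le a k (\<lambda>z. det (pencil I B z))"
  unfolding line_degree_le_def pencil_line
proof
  fix z
  obtain p where "degree p \<le> rank (pencil I B (cvec a))"
    "\<And>s. det (\<chi> i j. pencil I B z $ i $ j + s * pencil I B (cvec a) $ i $ j) = poly p s"
    using det_degree_le_rank[of "pencil I B (cvec a)" "pencil I B z"] by blast
  then show "\<exists>p. degree p \<le> k \<and>
      (\<forall>s. det (\<chi> i j. pencil I B z $ i $ j + s * pencil I B (cvec a) $ i $ j) = poly p s)"
    using assms by (intro exI[of _ p]) simp
qed

text \<open>A permutation other than the identity moves at least two indices, so after one factor of
  its Leibniz term is differentiated, an off-diagonal zero of \<open>mat t\<close> remains in the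
  product.\<close>

lemma deriv_det_mat_1:
  fixes A :: "complex^'n^'n"
  assumes "t \<noteq> 0"
  shows "((\<lambda>s. det (\<chi> i j. mat t $ i $ j + s * A $ i $ j)) has_field_derivative
    t ^ CARD('n) * trace A / t) (at 0)"
proof -
  let ?M = "\<lambda>s. \<chi> i j. mat t $ i $ j + s * A $ i $ j"
  have prod: "((\<lambda>s. \<Prod>i\<in>UNIV. mat t $ i $ \<sigma> i + s * A $ i $ \<sigma> i) has_field_derivative
      (if \<sigma> = id then t ^ CARD('n) * trace A / t else 0)) (at 0)"
    if \<sigma>: "\<sigma> permutes UNIV" for \<sigma>
  proof -
    have "((\<lambda>s. \<Prod>i\<in>UNIV. mat t $ i $ \<sigma> i + s * A $ i $ \<sigma> i) has_field_derivative
        (\<Sum>i\<in>UNIV. A $ i $ \<sigma> i * (\<Prod>j\<in>UNIV - {i}. mat t $ j $ \<sigma> j + 0 * A $ j $ \<sigma> j))) (at 0)"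
      by (rule has_field_derivative_prod) (auto intro!: derivative_eq_intros)
    moreover have "(\<Sum>i\<in>UNIV. A $ i $ \<sigma> i * (\<Prod>j\<in>UNIV - {i}. mat t $ j $ \<sigma> j + 0 * A $ j $ \<sigma> j))
        = (if \<sigma> = id then t ^ CARD('n) * trace A / t else 0)"
    proof (cases "\<sigma> = id")
      case True
      have "(\<Prod>j\<in>UNIV - {i}. mat t $ j $ \<sigma> j + 0 * A $ j $ \<sigma> j) = t ^ CARD('n) / t" for i :: 'n
        using True assms by (simp add: mat_def card_Diff_singleton power_diff)
      then show ?thesis using True by (simp add: trace_def sum_distrib_left sum_divide_distrib mult.commute)
    next
      case False
      then obtain i0 where i0: "\<sigma> i0 \<noteq> i0" by (auto simp: fun_eq_iff)
      have "(\<Prod>j\<in>UNIV - {i}. mat t $ j $ \<sigma> j + 0 * A $ j $ \<sigma> j) = 0" for i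
      proof -
        have "\<sigma> (\<sigma> i0) \<noteq> \<sigma> i0" using i0 permutes_inj[OF \<sigma>] by (auto dest: injD)
        then have "\<exists>j\<in>UNIV - {i}. \<sigma> j \<noteq> j" using i0 by (metis DiffI UNIV_I singletonD)
        then obtain j where "j \<in> UNIV - {i}" "\<sigma> j \<noteq> j" by blast
        then show ?thesis by (intro prod_zero) (auto simp: mat_def intro!: bexI[of _ j])
      qed
      then show ?thesis using False by (simp only: mult_zero_right sum.neutral_const if_False)
    qed
    ultimately show ?thesis by simp
  qed
  have "((\<lambda>s. \<Sum>\<sigma> | \<sigma> permutes UNIV. of_int (sign \<sigma>) * (\<Prod>i\<in>UNIV. mat t $ i $ \<sigma> i + s * A $ i $ \<sigma> i))
      has_field_derivative (\<Sum>\<sigma> | \<sigma> permutes (UNIV :: 'n set). of_int (sign \<sigma>) *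
        (if \<sigma> = id then t ^ CARD('n) * trace A / t else 0))) (at 0)"
    by (intro DERIV_sum DERIV_cmult prod) auto
  moreover have "(\<Sum>\<sigma> | \<sigma> permutes (UNIV :: 'n set). of_int (sign \<sigma>) *
        (if \<sigma> = id then t ^ CARD('n) * trace A / t else 0)) = t ^ CARD('n) * trace A / t"
    by (subst sum.remove[of _ id]) (auto simp: permutes_id sign_id intro!: sum.neutral)
  ultimately show ?thesis by (simp add: det_def)
qed

text \<open>Jacobi's formula at t I. This is how the traces of the means become the initial
  barriers.\<close>

lemma barrier_det_pencil:
  fixes B :: "'v \<Rightarrow> complex^'d^'d"
  assumes one: "pencil I B (cvec p) = mat 1" and t: "0 < t"
  shows "barrier a (\<lambda>z. det (pencil I B z)) (\<lambda>v. t * p v) = Re (trace (pencil I B (cvec a))) / t"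
proof -
  let ?T = "complex_of_real t"
  have mat_t: "pencil I B (cvec (\<lambda>v. t * p v)) = mat ?T"
  proof -
    have "pencil I B (cvec (\<lambda>v. t * p v)) $ i $ j = ?T * (pencil I B (cvec p)) $ i $ j" for i j
      by (simp add: pencil_def cvec_def sum_distrib_left algebra_simps)
    then show ?thesis by (simp add: one mat_def vec_eq_iff)
  qed
  have "dderiv a (\<lambda>z. det (pencil I B z)) (cvec (\<lambda>v. t * p v))
      = ?T ^ CARD('d) * trace (pencil I B (cvec a)) / ?T"
    unfolding dderiv_def pencil_line mat_t using t by (intro DERIV_imp_deriv deriv_det_mat_1) simp
  moreover have "det (mat ?T :: complex^'d^'d) = ?T ^ CARD('d)"
    by (subst det_diagonal) (simp_all add: mat_def)
  ultimately show ?thesis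
    using t by (simp add: barrier_def mat_t)
qed

section \<open>The spectral norm\<close>

lemma pos_semidef_iff: "pos_semidef A \<longleftrightarrow> hermitian A \<and> (\<forall>x. 0 \<le> x \<bullet> (A *v x))"
  by (simp add: pos_semidef_def cform_def[symmetric] Re_cform)

lemma hermitian_inner_commute:
  fixes A :: "complex^'n^'n"
  assumes "hermitian A"
  shows "u \<bullet> (A *v v) = v \<bullet> (A *v u)"
proof -
  have "(\<Sum>i\<in>UNIV. cnj (u $ i) * (A *v v) $ i) = (\<Sum>i\<in>UNIV. \<Sum>j\<in>UNIV. cnj (u $ i) * A $ i $ j * v $ j)"
    by (simp add: matrix_vector_mult_def sum_distrib_left mult.assoc)
  also have "\<dots> = (\<Sum>j\<in>UNIV. \<Sum>i\<in>UNIV. cnj (u $ i) * A $ i $ j * v $ j)"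
    by (rule sum.swap)
  also have "\<dots> = (\<Sum>j\<in>UNIV. \<Sum>i\<in>UNIV. v $ j * cnj (A $ j $ i * u $ i))"
    using assms unfolding hermitian_def
    by (intro sum.cong refl) (metis (no_types, opaque_lifting) complex_cnj_mult mult.assoc mult.commute)
  also have "\<dots> = cnj (\<Sum>j\<in>UNIV. cnj (v $ j) * (A *v u) $ j)"
    by (simp add: matrix_vector_mult_def sum_distrib_left)
  finally have "Re (\<Sum>i\<in>UNIV. cnj (u $ i) * (A *v v) $ i) = Re (\<Sum>j\<in>UNIV. cnj (v $ j) * (A *v u) $ j)"
    by (simp only: complex_cnj)  simp
  then show ?thesis by (simp add: inner_vec_def inner_complex_def)
qed

lemma matrix_vector_mult_scaleR_complex: "A *v (c *\<^sub>R x) = c *\<^sub>R (A *v x)"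
  for A :: "complex^'n^'m"
  by (simp add: matrix_vector_mult_def vec_eq_iff scaleR_sum_right)

lemma pos_semidef_Cauchy_Schwarz:
  assumes "pos_semidef A"
  shows "(u \<bullet> (A *v v))\<^sup>2 \<le> (u \<bullet> (A *v u)) * (v \<bullet> (A *v v))"
proof -
  have herm: "hermitian A" and pos: "\<And>x. 0 \<le> x \<bullet> (A *v x)"
    using assms by (auto simp: pos_semidef_iff)
  define a b c where "a = v \<bullet> (A *v v)" and "b = u \<bullet> (A *v v)" and "c = u \<bullet> (A *v u)"
  have quad: "0 \<le> c + 2 * s * b + s\<^sup>2 * a" for s
  proof -
    have "(u + s *\<^sub>R v) \<bullet> (A *v (u + s *\<^sub>R v)) = c + s * b + s * (v \<bullet> (A *v u)) + s * (s * a)"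
      by (simp add: a_def b_def c_def matrix_vector_right_distrib matrix_vector_mult_scaleR_complex
          inner_add_left inner_add_right distrib_left)
    also have "\<dots> = c + 2 * s * b + s\<^sup>2 * a"
      using hermitian_inner_commute[OF herm, of v u] by (simp add: b_def power2_eq_square)
    finally show ?thesis using pos by metis
  qed
  have "b\<^sup>2 \<le> c * a"
  proof (cases "a = 0")
    case True
    have "b = 0"
    proof (rule ccontr)
      assume "b \<noteq> 0"
      \<comment> \<open>For a = 0 the form is affine in s, and this s gives it the value -1.\<close>
      then show False using quad[of "- (c + 1) / (2 * b)"] True by (simp add: field_simps)
    qed
    then show ?thesis using True by simp
  next
    case False
    then have "a > 0" using pos[of v] by (simp add: a_def)
    then show ?thesis
      using quad[of "- b / a"] by (simp add: field_simps power2_eq_square)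
  qed
  then show ?thesis by (simp add: a_def b_def c_def)
qed

text \<open>The maximum of the Rayleigh quotient is attained, at an eigenvector; both the spectral bound
  and the norm bound then follow from Cauchy-Schwarz for semidefinite forms.\<close>

lemma op_norm_le_of_det_nonzero:
  fixes A :: "complex^'n^'n"
  assumes psd: "pos_semidef A" and det: "\<And>r. 0 \<le> r \<Longrightarrow> det (mat (of_real (b + r)) - A) \<noteq> 0"
  shows "op_norm A \<le> b"
proof -
  have herm: "hermitian A" and pos: "\<And>x. 0 \<le> x \<bullet> (A *v x)"
    using psd by (auto simp: pos_semidef_iff)
  let ?f = "\<lambda>x::complex^'n. x \<bullet> (A *v x)"
  have "continuous_on (sphere 0 1) ?f"
    unfolding matrix_vector_mult_def by (intro continuous_intros)
  moreover have "sphere 0 1 \<noteq> ({} :: (complex^'n) set)" by simp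
  ultimately obtain x0 where x0: "norm x0 = 1" "\<And>y. norm y = 1 \<Longrightarrow> ?f y \<le> ?f x0"
    using continuous_attains_sup[of "sphere (0 :: complex^'n) 1" ?f] by auto
  define l where "l = ?f x0"
  have scale: "?f x \<le> l * (norm x)\<^sup>2" for x
  proof (cases "x = 0")
    case False
    define y where "y = (1 / norm x) *\<^sub>R x"
    have "norm y = 1" using False by (simp add: y_def)
    then have "?f y \<le> l" using x0(2) by (simp add: l_def)
    moreover have "?f y = ?f x / (norm x)\<^sup>2"
      by (simp add: y_def matrix_vector_mult_scaleR_complex power2_eq_square)
    ultimately show ?thesis using False by (simp add: divide_le_eq)
  qed simp
  have T: "(mat (of_real l) - A) *v x = l *\<^sub>R x - A *v x" for x
  proof -
    have "(mat (complex_of_real l) *v x) $ i = l *\<^sub>R (x $ i)" for i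
      by (simp add: matrix_vector_mult_def mat_def if_distrib if_distribR sum.delta' scaleR_conv_of_real
          cong: if_cong)
    then show ?thesis by (simp add: matrix_vector_mult_diff_rdistrib vec_eq_iff)
  qed
  have "hermitian (mat (of_real l) - A)"
    unfolding hermitian_def
  proof (intro allI)
    fix i j
    have "A $ i $ j = cnj (A $ j $ i)" using herm unfolding hermitian_def by blast
    then show "(mat (of_real l) - A) $ i $ j = cnj ((mat (of_real l) - A) $ j $ i)"
      by (simp add: mat_def)
  qed
  then have T_psd: "pos_semidef (mat (of_real l) - A)"
    using scale by (simp add: pos_semidef_iff T inner_diff_right power2_norm_eq_inner)
  have "(mat (of_real l) - A) *v x0 = 0"
  proof -
    let ?u = "(mat (of_real l) - A) *v x0"
    have "x0 \<bullet> ?u = 0"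
    proof -
      have "x0 \<bullet> x0 = 1" using x0(1) by (simp add: dot_square_norm)
      then show ?thesis unfolding T inner_diff_right inner_scaleR_right by (simp add: l_def)
    qed
    then have "(?u \<bullet> ?u)\<^sup>2 \<le> 0"
      using pos_semidef_Cauchy_Schwarz[OF T_psd, of ?u x0] by simp
    then show ?thesis by simp
  qed
  moreover have "x0 \<noteq> 0" using x0(1) by auto
  ultimately have "det (mat (of_real l) - A) = 0"
    by (metis invertible_det_nz invertible_left_inverse matrix_left_invertible_ker)
  then have l_le: "l \<le> b"
    using det[of "l - b"] by fastforce
  have "norm (A *v x) \<le> l * norm x" for x
  proof -
    let ?y = "A *v x"
    have "l \<ge> 0" using pos by (simp add: l_def)
    have "((norm ?y)\<^sup>2)\<^sup>2 = (?y \<bullet> (A *v x))\<^sup>2" by (simp add: power2_norm_eq_inner)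
    also have "\<dots> \<le> ?f ?y * ?f x" by (rule pos_semidef_Cauchy_Schwarz[OF psd])
    also have "\<dots> \<le> (l * (norm ?y)\<^sup>2) * (l * (norm x)\<^sup>2)"
      using scale pos \<open>l \<ge> 0\<close> by (intro mult_mono) auto
    finally have "(norm ?y)\<^sup>2 * (norm ?y)\<^sup>2 \<le> (norm ?y)\<^sup>2 * (l * norm x)\<^sup>2"
      by (simp add: power2_eq_square algebra_simps)
    then show ?thesis
    proof (cases "?y = 0")
      case False
      then have "0 < (norm ?y)\<^sup>2" by simp
      with mult_le_cancel_left_pos[OF this]
        \<open>(norm ?y)\<^sup>2 * (norm ?y)\<^sup>2 \<le> (norm ?y)\<^sup>2 * (l * norm x)\<^sup>2\<close>
      have "(norm ?y)\<^sup>2 \<le> (l * norm x)\<^sup>2" by blast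
      then show ?thesis by (rule power2_le_imp_le) (use \<open>l \<ge> 0\<close> in simp)
    qed (use \<open>l \<ge> 0\<close> in simp)
  qed
  then have "op_norm A \<le> l" unfolding op_norm_def by (rule onorm_le)
  with l_le show ?thesis by simp
qed

section \<open>From polynomials to a selection of matrices\<close>

lemma pencil_lincomb:
  "pencil I B (cvec (\<lambda>v. \<Sum>j\<in>J. c j * b j v)) = (\<Sum>j\<in>J. c j *\<^sub>R pencil I B (cvec (b j)))"
proof -
  have "(\<Sum>j\<in>J. c j *\<^sub>R pencil I B (cvec (b j))) $ x $ y
      = pencil I B (cvec (\<lambda>v. \<Sum>j\<in>J. c j * b j v)) $ x $ y" for x y
  proof -
    have "(\<Sum>j\<in>J. c j *\<^sub>R pencil I B (cvec (b j))) $ x $ y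
        = (\<Sum>j\<in>J. \<Sum>v\<in>I. c j *\<^sub>R (cvec (b j) v * B v $ x $ y))"
      by (simp add: pencil_def scaleR_sum_right)
    also have "\<dots> = (\<Sum>v\<in>I. \<Sum>j\<in>J. c j *\<^sub>R (cvec (b j) v * B v $ x $ y))"
      by (rule sum.swap)
    also have "\<dots> = pencil I B (cvec (\<lambda>v. \<Sum>j\<in>J. c j * b j v)) $ x $ y"
      by (simp add: pencil_def cvec_def sum_distrib_right scaleR_conv_of_real mult.assoc)
    finally show ?thesis .
  qed
  then show ?thesis by (simp add: vec_eq_iff)
qed

text \<open>Variables are pairs \<open>(i, w)\<close> with \<open>w\<close> a value of the \<open>i\<close>-th matrix.\<close>

lemma matrix_selection:
  fixes S :: "nat \<Rightarrow> (complex^'d^'d) set" and \<delta> t :: real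
  assumes fin: "\<And>i. finite (S i)" and psd: "\<And>i w. w \<in> S i \<Longrightarrow> pos_semidef w"
    and p: "\<And>i w. w \<in> S i \<Longrightarrow> 0 < p i w" and p1: "\<And>i. i \<in> {1..m} \<Longrightarrow> (\<Sum>w\<in>S i. p i w) = 1"
    and one: "(\<Sum>i=1..m. \<Sum>w\<in>S i. p i w *\<^sub>R w) = mat 1"
    and tr: "\<And>i. i \<in> {1..m} \<Longrightarrow> Re (trace (\<Sum>w\<in>S i. p i w *\<^sub>R w)) \<le> \<epsilon>"
    and rank: "\<And>i. i \<in> {1..m} \<Longrightarrow> rank (\<Sum>w\<in>S i. p i w *\<^sub>R w) \<le> k"
    and k: "k \<ge> 2" and \<delta>: "0 < \<delta>" and t: "0 < t"
    and cond: "(\<epsilon> / t) / (1 + \<delta> * (\<epsilon> / t) / (real k - 1)) \<le> 1 - 1 / \<delta>"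
  obtains f where "\<And>i. i \<in> {1..m} \<Longrightarrow> f i \<in> S i" "op_norm (\<Sum>i=1..m. f i) \<le> t + \<delta>"
proof -
  define I where "I = Sigma {1..m} S"
  define B :: "nat \<times> (complex^'d^'d) \<Rightarrow> complex^'d^'d" where "B = snd"
  define e where "e i w = (\<lambda>v. if v = (i, w) then 1 else (0::real))" for i :: nat and w :: "complex^'d^'d"
  define a where "a i = (\<lambda>v. \<Sum>w\<in>S i. p i w * e i w v)" for i
  \<comment> \<open>The direction at which the pencil is the identity, so that t P represents t
    I.\<close>
  define P where "P = (\<lambda>v. \<Sum>i=1..m. a i v)"
  have finI: "finite I" using fin by (simp add: I_def)
  have psdB: "pos_semidef (B v)" if "v \<in> I" for v
    using that psd by (auto simp: I_def B_def)
  have pencil_e: "pencil I B (cvec (e i w)) = w" if "i \<in> {1..m}" "w \<in> S i" for i w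
  proof -
    have "(i, w) \<in> I" using that by (simp add: I_def)
    then show ?thesis
      using finI by (simp add: vec_eq_iff pencil_def cvec_def e_def B_def if_distrib if_distribR
          sum.delta' cong: if_cong)
  qed
  have pencil_a: "pencil I B (cvec (a i)) = (\<Sum>w\<in>S i. p i w *\<^sub>R w)" if "i \<in> {1..m}" for i
    unfolding a_def pencil_lincomb using that by (simp add: pencil_e)
  have pencil_P: "pencil I B (cvec P) = mat 1"
    using pencil_lincomb[of I B "\<lambda>_. 1" a "{1..m}"] pencil_a
    by (simp add: P_def one del: One_nat_def)
  have e0: "0 \<le> e i w v" for i w v by (simp add: e_def)
  have a0: "0 \<le> a i v" for i v
    unfolding a_def using e0 p by (intro sum_nonneg mult_nonneg_nonneg) (auto intro: less_imp_le)
  have P0: "0 \<le> P v" for v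
    unfolding P_def using a0 by (intro sum_nonneg)
  let ?h = "\<lambda>z. det (pencil I B z)"
  obtain f where f: "\<And>i. i \<in> {1..m} \<Longrightarrow> f i \<in> S i"
    "above_roots ?h (\<lambda>v. (t + \<delta>) * (\<Sum>i=1..m. a i v) - (\<Sum>i=1..m. e i (f i) v))"
  proof (rule above_roots_selection[where h = ?h and S = S and e = e and p = p and a = a and t = t
        and k = k and \<phi> = "\<epsilon> / t" and \<delta> = \<delta> and m = m])
    show "real_stable ?h"
      by (rule real_stable_det_pencil[OF finI]) (use psdB P0 pencil_P in auto)
    show "above_roots ?h (\<lambda>v. t * (\<Sum>i=1..m. a i v))"
      using above_roots_det_pencil[where p = P and B = B and I = I] psdB pencil_P t by (simp add: P_def)
    show "line_degree_le (a i) k ?h" if "i \<in> {1..m}" for i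
      using rank[OF that] by (intro line_degree_le_det_pencil) (simp add: pencil_a[OF that])
    show "barrier (a i) ?h (\<lambda>v. t * (\<Sum>i=1..m. a i v)) \<le> \<epsilon> / t" if "i \<in> {1..m}" for i
      using barrier_det_pencil[OF pencil_P t, of "a i"] tr[OF that] t pencil_a[OF that]
      by (simp add: P_def divide_right_mono)
  qed (use fin e0 p p1 k \<delta> cond a_def in auto)
  define A where "A = (\<Sum>i=1..m. f i)"
  have A_psd: "pos_semidef A"
  proof -
    have f_psd: "hermitian (f i)" "0 \<le> x \<bullet> (f i *v x)" if "i \<in> {1..m}" for i x
      using psd[OF f(1)[OF that]] by (auto simp: pos_semidef_iff)
    have "hermitian A"
      unfolding hermitian_def A_def sum_component cnj_sum
    proof (intro allI sum.cong refl)
      fix i j x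
      assume "x \<in> {1..m}"
      then show "f x $ i $ j = cnj (f x $ j $ i)"
        using f_psd(1) unfolding hermitian_def by blast
    qed
    moreover have "x \<bullet> (A *v x) = (\<Sum>i=1..m. x \<bullet> (f i *v x))" for x
    proof -
      have "A *v x = (\<Sum>i=1..m. f i *v x)"
        unfolding A_def by (induction m) (simp_all add: matrix_vector_mult_add_rdistrib)
      then show ?thesis by (simp add: inner_sum_right)
    qed
    ultimately show ?thesis
      using f_psd(2) unfolding pos_semidef_iff by (auto intro!: sum_nonneg)
  qed
  have "det (mat (of_real (t + \<delta> + r)) - A) \<noteq> 0" if r: "0 \<le> r" for r
  proof -
    let ?y = "\<lambda>v. (t + \<delta>) * (\<Sum>i=1..m. a i v) - (\<Sum>i=1..m. e i (f i) v)"
    \<comment> \<open>Moving up from the selected point by r P adds r I to the pencil, which tests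
      every real number from t + \<delta> upwards as an eigenvalue of A.\<close>
    have "?h (cvec (\<lambda>v. ?y v + r * P v)) \<noteq> 0"
      using P0 r by (intro above_rootsD[OF f(2)]) simp
    moreover have "pencil I B (cvec (\<lambda>v. ?y v + r * P v)) = mat (of_real (t + \<delta> + r)) - A"
    proof -
      have "pencil I B (cvec (\<lambda>v. ?y v + r * P v)) $ x $ y
          = of_real (t + \<delta> + r) * pencil I B (cvec P) $ x $ y
            - pencil I B (cvec (\<lambda>v. \<Sum>i=1..m. 1 * e i (f i) v)) $ x $ y" for x y
        by (simp add: pencil_def cvec_def P_def sum_distrib_left sum_subtractf[symmetric] algebra_simps
            sum.distrib[symmetric])
      moreover have "pencil I B (cvec (\<lambda>v. \<Sum>i=1..m. 1 * e i (f i) v)) = A"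
        unfolding pencil_lincomb using f(1) by (simp add: pencil_e A_def)
      ultimately show ?thesis
        by (simp add: vec_eq_iff pencil_P mat_def)
    qed
    ultimately show ?thesis by simp
  qed
  then have "op_norm A \<le> t + \<delta>" by (rule op_norm_le_of_det_nonzero[OF A_psd])
  with f(1) that show ?thesis unfolding A_def by blast
qed

section \<open>Random matrices\<close>

text \<open>For \<delta> > 1 the last condition reads t \<ge> \<epsilon> \<delta> / (\<delta> - 1) -
  \<delta> \<epsilon> / K. With \<delta> = 1 + y, s = sqrt (1 - \<epsilon> / K) and r = sqrt
  \<epsilon>, the least value of t + \<delta> is s^2 + r^2 + s^2 y + r^2 / y, which is minimal at y
  = r / s with value (s + r)^2.\<close>

lemma barrier_parameters:
  fixes \<epsilon> K \<eta> :: real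
  assumes \<epsilon>: "0 < \<epsilon>" and K: "0 < K" and \<epsilon>K: "\<epsilon> * (K + 1) \<le> K\<^sup>2" and \<eta>: "0 < \<eta>"
  obtains t \<delta> where "0 < t" "0 < \<delta>" "t + \<delta> = (sqrt (1 - \<epsilon> / K) + sqrt \<epsilon>)\<^sup>2 + \<eta>"
    "(\<epsilon> / t) / (1 + \<delta> * (\<epsilon> / t) / K) \<le> 1 - 1 / \<delta>"
proof -
  have "\<epsilon> * K < K\<^sup>2" using \<epsilon>K \<epsilon> by (simp add: algebra_simps)
  then have "\<epsilon> < K" using K by (simp add: power2_eq_square)
  define s r where "s = sqrt (1 - \<epsilon> / K)" and "r = sqrt \<epsilon>"
  have s2: "s\<^sup>2 = 1 - \<epsilon> / K" and s: "0 < s" using \<open>\<epsilon> < K\<close> K by (simp_all add: s_def)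
  have r2: "r\<^sup>2 = \<epsilon>" and r: "0 < r" using \<epsilon> by (simp_all add: r_def)
  define y where "y = r / s"
  have y: "0 < y" using r s by (simp add: y_def)
  have ys: "y * s = r" using s by (simp add: y_def)
  \<comment> \<open>Squared out, this is exactly the assumption \<open>\<epsilon>K\<close>; it makes
    t0 nonnegative.\<close>
  have yK: "y \<le> K"
  proof -
    have "r\<^sup>2 \<le> (K * s)\<^sup>2"
    proof -
      have "K\<^sup>2 * (1 - \<epsilon> / K) = K\<^sup>2 - \<epsilon> * K"
        using K by (simp add: right_diff_distrib power2_eq_square)
      moreover have "\<epsilon> * (K + 1) = \<epsilon> * K + \<epsilon>" by (simp add: distrib_left)
      ultimately show ?thesis using \<epsilon>K unfolding power_mult_distrib r2 s2 by linarith
    qed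
    then have "r \<le> K * s" by (rule power2_le_imp_le) (use K s in simp)
    then show ?thesis using s by (simp add: y_def divide_le_eq)
  qed
  define \<delta> where "\<delta> = 1 + y"
  \<comment> \<open>The least t allowed for this \<delta>. It is 0 when y = K, hence the additional
    \<eta>.\<close>
  define t0 where "t0 = \<epsilon> * (1 + y) * (K - y) / (K * y)"
  define t where "t = t0 + \<eta>"
  have t0: "0 \<le> t0" using \<epsilon> y yK K by (simp add: t0_def)
  have t: "0 < t" using t0 \<eta> by (simp add: t_def)
  have \<delta>: "0 < \<delta>" using y by (simp add: \<delta>_def)
  have "t0 = \<epsilon> / y - \<epsilon> / K + \<epsilon> - \<epsilon> / K * y"
    using y K by (simp add: t0_def field_simps power2_eq_square)
  moreover have "\<epsilon> / y = r * s"
    using r s by (simp add: y_def r2[symmetric] power2_eq_square)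
  moreover have "y - \<epsilon> / K * y = r * s"
  proof -
    have "y - \<epsilon> / K * y = y * (1 - \<epsilon> / K)" by (simp add: right_diff_distrib)
    also have "\<dots> = y * s * s" unfolding s2[symmetric] by (simp add: power2_eq_square)
    finally show ?thesis unfolding ys .
  qed
  ultimately have "t0 + \<delta> = s\<^sup>2 + r\<^sup>2 + 2 * (r * s)"
    unfolding s2 r2 \<delta>_def by linarith
  then have sum: "t + \<delta> = (s + r)\<^sup>2 + \<eta>"
    by (simp add: t_def power2_sum mult.commute)
  have cond: "(\<epsilon> / t) / (1 + \<delta> * (\<epsilon> / t) / K) \<le> 1 - 1 / \<delta>"
  proof -
    have "(\<epsilon> / t) / (1 + \<delta> * (\<epsilon> / t) / K) = \<epsilon> / (t + \<delta> * \<epsilon> / K)"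
    proof -
      have "t + \<delta> * \<epsilon> / K = t * (1 + \<delta> * (\<epsilon> / t) / K)" using t by (simp add: algebra_simps)
      then show ?thesis using t by simp
    qed
    also have "\<dots> \<le> y / (1 + y)"
    proof -
      have "\<epsilon> * (1 + y) = y * (t0 + \<delta> * \<epsilon> / K)"
        using y K by (simp add: t0_def \<delta>_def field_simps)
      also have "\<dots> \<le> y * (t + \<delta> * \<epsilon> / K)"
        using y \<eta> by (intro mult_left_mono) (auto simp: t_def)
      finally have "\<epsilon> * (1 + y) \<le> y * (t + \<delta> * \<epsilon> / K)" .
      moreover have "0 < t + \<delta> * \<epsilon> / K" using t \<delta> \<epsilon> K by (simp add: add_pos_nonneg)
      ultimately show ?thesis using y by (simp add: divide_simps mult.commute)
    qed
    also have "y / (1 + y) = 1 - 1 / \<delta>"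
      using y by (simp add: \<delta>_def field_simps)
    finally show ?thesis .
  qed
  show ?thesis using that[OF t \<delta> _ cond] sum unfolding s_def r_def by blast
qed

section \<open>Measurability of the norm event and atoms of random variables\<close>

lemma bounded_linear_matrix_vector_mult:
  "bounded_linear ((*v) A)" for A :: "complex^'n^'m"
  by (rule linear_conv_bounded_linear[THEN iffD1])
    (auto intro!: linearI simp: matrix_vector_right_distrib matrix_vector_mult_scaleR_complex)

lemma op_norm_le_iff:
  fixes A :: "complex^'n^'n"
  assumes "0 \<le> b"
  shows "op_norm A \<le> b \<longleftrightarrow> (\<forall>x. norm (A *v x) \<le> b * norm x)"
proof -
  note bounded_linear_matrix_vector_mult[of A]
  then show ?thesis
    unfolding op_norm_def
    by (meson norm_ge_zero mult_right_mono onorm onorm_le order_trans)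
qed

text \<open>Makes the event of the final theorem measurable: for nonnegative b the set is an
  intersection of closed conditions, one for each vector.\<close>

lemma closed_op_norm_le: "closed {A :: complex^'n^'n. op_norm A \<le> b}"
proof (cases "0 \<le> b")
  case True
  have "closed {A :: complex^'n^'n. norm (A *v x) \<le> b * norm x}" for x
    unfolding matrix_vector_mult_def by (intro closed_Collect_le continuous_intros)
  then show ?thesis
    using True by (simp add: op_norm_le_iff closed_Collect_all)
next
  case False
  have "0 \<le> op_norm A" for A :: "complex^'n^'n"
    unfolding op_norm_def by (rule onorm_pos_le[OF bounded_linear_matrix_vector_mult])
  then have "\<not> op_norm A \<le> b" for A :: "complex^'n^'n"
    using False order_trans by blast
  then have "{A :: complex^'n^'n. op_norm A \<le> b} = {}" by simp
  then show ?thesis by simp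
qed

context prob_space
begin

lemma
  fixes c :: "'b::{banach, second_countable_topology}"
  assumes "A \<in> events"
  shows integrable_indicator_scaleR: "integrable M (\<lambda>\<omega>. indicat_real A \<omega> *\<^sub>R c)"
    and integral_indicator_scaleR: "(LINT \<omega>|M. indicat_real A \<omega> *\<^sub>R c) = prob A *\<^sub>R c"
  using assms by (simp_all add: emeasure_eq_measure)

lemma sum_indicator_atoms:
  fixes f :: "'b \<Rightarrow> 'c::real_vector"
  assumes "finite S" "X \<omega> \<in> S" "\<omega> \<in> space M"
  shows "(\<Sum>w\<in>S. indicat_real (X -` {w} \<inter> space M) \<omega> *\<^sub>R f w) = f (X \<omega>)"
proof -
  have "(\<Sum>w\<in>S. indicat_real (X -` {w} \<inter> space M) \<omega> *\<^sub>R f w) = (\<Sum>w\<in>S. if w = X \<omega> then f w else 0)"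
    using assms(3) by (intro sum.cong) (auto simp: indicator_def)
  then show ?thesis using assms(1,2) by simp
qed

lemma finitely_supported_atoms:
  fixes X :: "'a \<Rightarrow> 'b::euclidean_space"
  assumes X: "random_variable borel X" and supp: "finitely_supported M X"
  defines "p \<equiv> \<lambda>w. prob (X -` {w} \<inter> space M)"
  obtains S where "finite S" "\<And>w. w \<in> S \<Longrightarrow> 0 < p w" "(\<Sum>w\<in>S. p w) = 1"
    "integral\<^sup>L M X = (\<Sum>w\<in>S. p w *\<^sub>R w)"
proof -
  obtain T where T: "finite T" "AE \<omega> in M. X \<omega> \<in> T"
    using supp by (auto simp: finitely_supported_def)
  \<comment> \<open>Values of probability 0 are dropped from T, so that every remaining value can be
    selected with positive weight.\<close>
  define S where "S = {w\<in>T. 0 < p w}"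
  have fin: "finite S" using T(1) by (simp add: S_def)
  have meas: "X -` {w} \<inter> space M \<in> events" for w
    using X by (rule measurable_sets) simp
  have "AE \<omega> in M. X \<omega> \<noteq> w" if "w \<in> T - S" for w
  proof -
    have "p w = 0" using that by (simp add: S_def p_def zero_less_measure_iff)
    then have "X -` {w} \<inter> space M \<in> null_sets M"
      using meas by (auto simp: p_def emeasure_eq_measure null_sets_def)
    then have "AE \<omega> in M. \<omega> \<notin> X -` {w} \<inter> space M" by (rule AE_not_in)
    then show ?thesis by (rule AE_mp) (auto intro!: AE_I2)
  qed
  then have "AE \<omega> in M. \<forall>w\<in>T - S. X \<omega> \<noteq> w"
    using T(1) by (intro AE_finite_allI) auto
  with T(2) have S_AE: "AE \<omega> in M. X \<omega> \<in> S"
    by eventually_elim auto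
  show ?thesis
  proof
    show "finite S" by (rule fin)
    show "0 < p w" if "w \<in> S" for w using that by (simp add: S_def)
    have "integral\<^sup>L M X = (LINT \<omega>|M. (\<Sum>w\<in>S. indicat_real (X -` {w} \<inter> space M) \<omega> *\<^sub>R w))"
    proof (rule integral_cong_AE)
      show "AE \<omega> in M. X \<omega> = (\<Sum>w\<in>S. indicat_real (X -` {w} \<inter> space M) \<omega> *\<^sub>R w)"
        using S_AE AE_space 
        by eventually_elim (rule sum_indicator_atoms[OF fin, symmetric])
      show "(\<lambda>\<omega>. \<Sum>w\<in>S. indicat_real (X -` {w} \<inter> space M) \<omega> *\<^sub>R w) \<in> borel_measurable M"
        by (intro borel_measurable_sum borel_measurable_integrable integrable_indicator_scaleR meas)
    qed (rule X)
    also have "\<dots> = (\<Sum>w\<in>S. p w *\<^sub>R w)"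
      by (subst Bochner_Integration.integral_sum) (simp_all only: integrable_indicator_scaleR integral_indicator_scaleR meas p_def)
    finally show "integral\<^sup>L M X = (\<Sum>w\<in>S. p w *\<^sub>R w)" .
    have "1 = (LINT \<omega>|M. (1::real))" by (simp add: prob_space)
    also have "\<dots> = (LINT \<omega>|M. (\<Sum>w\<in>S. indicat_real (X -` {w} \<inter> space M) \<omega> *\<^sub>R 1))"
    proof (rule integral_cong_AE)
      show "AE \<omega> in M. 1 = (\<Sum>w\<in>S. indicat_real (X -` {w} \<inter> space M) \<omega> *\<^sub>R (1::real))"
        using S_AE AE_space
        by eventually_elim (rule sum_indicator_atoms[OF fin, symmetric])
      show "(\<lambda>\<omega>. \<Sum>w\<in>S. indicat_real (X -` {w} \<inter> space M) \<omega> *\<^sub>R (1::real)) \<in> borel_measurable M"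
        by (intro borel_measurable_sum borel_measurable_integrable integrable_indicator_scaleR meas)
    qed simp
    also have "\<dots> = (\<Sum>w\<in>S. p w *\<^sub>R 1)"
      by (subst Bochner_Integration.integral_sum) (simp_all only: integrable_indicator_scaleR integral_indicator_scaleR meas p_def)
    finally show "(\<Sum>w\<in>S. p w) = 1" by simp
  qed
qed

end

theorem theorem1p4:
  fixes M :: "'w measure"
    and W :: "nat \<Rightarrow> 'w \<Rightarrow> complex^'d^'d"
    and k m :: nat
    and \<epsilon> :: real
  assumes "prob_space M"
    and "k \<ge> 2"
    and "0 < \<epsilon>" and "\<epsilon> \<le> (real k - 1)\<^sup>2 / real k"
    and "prob_space.indep_vars M (\<lambda>_. borel) W {1..m}"
    and "\<And>i. i \<in> {1..m} \<Longrightarrow> AE \<omega> in M. pos_semidef (W i \<omega>)"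
    and "\<And>i. i \<in> {1..m} \<Longrightarrow> finitely_supported M (W i)"
    and "(\<Sum>i=1..m. integral\<^sup>L M (W i)) = mat 1"
    and "\<And>i. i \<in> {1..m} \<Longrightarrow> Re (trace (integral\<^sup>L M (W i))) \<le> \<epsilon>"
    and "\<And>i. i \<in> {1..m} \<Longrightarrow> rank (integral\<^sup>L M (W i)) \<le> k"
  shows "measure M {\<omega> \<in> space M.
           op_norm (\<Sum>i=1..m. W i \<omega>) \<le> (sqrt (1 - \<epsilon> / (real k - 1)) + sqrt \<epsilon>)\<^sup>2} > 0"
proof -
  interpret prob_space M by (rule assms(1))
  have W_rv: "random_variable borel (W i)" if "i \<in> {1..m}" for i
    using assms(5) that by (auto simp: indep_vars_def)
  define p where "p i w = prob (W i -` {w} \<inter> space M)" for i w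
  \<comment> \<open>\<open>S i\<close> is made empty outside the range so that finiteness, positive
    weights and semidefiniteness hold for every i, as \<open>matrix_selection\<close>
    demands.\<close>
  have "\<exists>S. finite S \<and> (i \<in> {1..m} \<longrightarrow> (\<forall>w\<in>S. 0 < p i w) \<and> (\<Sum>w\<in>S. p i w) = 1 \<and>
      integral\<^sup>L M (W i) = (\<Sum>w\<in>S. p i w *\<^sub>R w)) \<and> (i \<notin> {1..m} \<longrightarrow> S = {})" for i
  proof (cases "i \<in> {1..m}")
    case True
    obtain S where "finite S" "\<And>w. w \<in> S \<Longrightarrow> 0 < p i w" "(\<Sum>w\<in>S. p i w) = 1"
      "integral\<^sup>L M (W i) = (\<Sum>w\<in>S. p i w *\<^sub>R w)"
      unfolding p_def using finitely_supported_atoms[OF W_rv[OF True] assms(7)[OF True]] by blast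
    then show ?thesis using True by (intro exI[of _ S]) auto
  qed (auto intro: exI[of _ "{}"])
  then have "\<exists>S. \<forall>i. finite (S i) \<and> (i \<in> {1..m} \<longrightarrow> (\<forall>w\<in>S i. 0 < p i w) \<and> (\<Sum>w\<in>S i. p i w) = 1 \<and>
      integral\<^sup>L M (W i) = (\<Sum>w\<in>S i. p i w *\<^sub>R w)) \<and> (i \<notin> {1..m} \<longrightarrow> S i = {})"
    by (intro choice allI)
  then obtain S where S_all: "\<forall>i. finite (S i) \<and> (i \<in> {1..m} \<longrightarrow> (\<forall>w\<in>S i. 0 < p i w) \<and>
      (\<Sum>w\<in>S i. p i w) = 1 \<and> integral\<^sup>L M (W i) = (\<Sum>w\<in>S i. p i w *\<^sub>R w)) \<and>
      (i \<notin> {1..m} \<longrightarrow> S i = {})" ..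
  have S: "finite (S i)" "i \<notin> {1..m} \<Longrightarrow> S i = {}"
    "i \<in> {1..m} \<Longrightarrow> (\<Sum>w\<in>S i. p i w) = 1"
    "i \<in> {1..m} \<Longrightarrow> integral\<^sup>L M (W i) = (\<Sum>w\<in>S i. p i w *\<^sub>R w)" for i
    using S_all[rule_format, of i] by blast+
  have p_pos: "0 < p i w" if "w \<in> S i" for i w
    using S_all[rule_format, of i] that by blast
  \<comment> \<open>Semidefiniteness is assumed almost surely, and an atom of positive probability
    cannot sit in the exceptional null set.\<close>
  have psd: "pos_semidef w" if w: "w \<in> S i" for i w
  proof (rule ccontr)
    assume neg: "\<not> pos_semidef w"
    have i: "i \<in> {1..m}" using S(2) w by blast
    have "AE \<omega> in M. \<omega> \<notin> W i -` {w} \<inter> space M"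
      using assms(6)[OF i] by eventually_elim (use neg in auto)
    then have "p i w = 0"
      unfolding p_def using measurable_sets[OF W_rv[OF i], of "{w}"]
      by (subst prob_eq_0) auto
    then show False using p_pos[OF w] by simp
  qed
  define b where "b = (sqrt (1 - \<epsilon> / (real k - 1)) + sqrt \<epsilon>)\<^sup>2"
  have k1: "0 < real k - 1" using assms(2) by simp
  have near: "\<exists>f\<in>Pi\<^sub>E {1..m} S. op_norm (\<Sum>i=1..m. f i) \<le> b + \<eta>" if \<eta>: "0 < \<eta>" for \<eta>
  proof -
    have "\<epsilon> * (real k - 1 + 1) \<le> (real k - 1)\<^sup>2"
      using assms(2,4) by (simp add: le_divide_eq)
    then obtain t \<delta> where t: "0 < t" "0 < \<delta>" "t + \<delta> = b + \<eta>"
      "(\<epsilon> / t) / (1 + \<delta> * (\<epsilon> / t) / (real k - 1)) \<le> 1 - 1 / \<delta>"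
      using barrier_parameters[OF assms(3) k1 _ \<eta>] unfolding b_def by blast
    obtain f where f: "\<And>i. i \<in> {1..m} \<Longrightarrow> f i \<in> S i" "op_norm (\<Sum>i=1..m. f i) \<le> t + \<delta>"
    proof (rule matrix_selection[where S = S and p = p and m = m and k = k and \<epsilon> = \<epsilon> and t = t and \<delta> = \<delta>])
      show "(\<Sum>i=1..m. \<Sum>w\<in>S i. p i w *\<^sub>R w) = mat 1"
        unfolding assms(8)[symmetric] by (intro sum.cong) (simp_all add: S(4))
      show "Re (trace (\<Sum>w\<in>S i. p i w *\<^sub>R w)) \<le> \<epsilon>" if "i \<in> {1..m}" for i
        using assms(9)[OF that] S(4)[OF that] by simp
      show "rank (\<Sum>w\<in>S i. p i w *\<^sub>R w) \<le> k" if "i \<in> {1..m}" for i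
        using assms(10)[OF that] S(4)[OF that] by simp
    qed (use S(1,3) psd p_pos assms(2) t in auto)
    have "restrict f {1..m} \<in> Pi\<^sub>E {1..m} S" using f(1) by auto
    moreover have "op_norm (\<Sum>i=1..m. restrict f {1..m} i) \<le> b + \<eta>"
      using f(2) t(3) by simp
    ultimately show ?thesis by blast
  qed
  \<comment> \<open>There are finitely many selections. If all their norms exceeded b, the minimum
    would do so by a fixed amount, against \<open>near\<close> with half that amount as
    slack.\<close>
  have "\<exists>f\<in>Pi\<^sub>E {1..m} S. op_norm (\<Sum>i=1..m. f i) \<le> b"
  proof (rule ccontr)
    let ?N = "(\<lambda>f. op_norm (\<Sum>i=1..m. f i)) ` Pi\<^sub>E {1..m} S"
    assume "\<not> ?thesis"
    then have gt: "b < x" if "x \<in> ?N" for x using that by auto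
    have fin: "finite ?N" using S(1) by (intro finite_imageI finite_PiE) auto
    have ne: "?N \<noteq> {}" using near[of 1] by auto
    have "b < Min ?N" using gt Min_in[OF fin ne] by blast
    then obtain f where "f \<in> Pi\<^sub>E {1..m} S" "op_norm (\<Sum>i=1..m. f i) \<le> b + (Min ?N - b) / 2"
      using near[of "(Min ?N - b) / 2"] by auto
    moreover from this have "Min ?N \<le> op_norm (\<Sum>i=1..m. f i)"
      using fin by (intro Min_le) auto
    ultimately show False using \<open>b < Min ?N\<close> by (simp add: field_simps)
  qed
  then obtain f where f: "f \<in> Pi\<^sub>E {1..m} S" "op_norm (\<Sum>i=1..m. f i) \<le> b" by blast
  \<comment> \<open>For m = 0 the means would sum to 0 instead of the identity. An intersection over
    an empty index set would not be confined to the sample space.\<close>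
  have "{1..m} \<noteq> {}"
  proof
    assume "{1..m} = {}"
    then have "(mat 1 :: complex^'d^'d) = 0" using assms(8) by simp
    then have "(mat 1 :: complex^'d^'d) $ i $ i = 0" for i by simp
    then show False by (simp add: mat_def)
  qed
  define E where "E = (\<Inter>i\<in>{1..m}. W i -` {f i} \<inter> space M)"
  \<comment> \<open>Independence turns the probability of the chosen combination into a product of
    positive atom weights.\<close>
  have "prob E = (\<Prod>i\<in>{1..m}. p i (f i))"
    unfolding E_def p_def
    by (rule indep_varsD[OF assms(5)]) (use \<open>{1..m} \<noteq> {}\<close> in auto)
  also have "\<dots> > 0"
    by (intro prod_pos p_pos PiE_mem[OF f(1)])
  finally have "0 < prob E" .
  also have "prob E \<le> prob {\<omega> \<in> space M. op_norm (\<Sum>i=1..m. W i \<omega>) \<le> b}"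
  proof (rule finite_measure_mono)
    show "E \<subseteq> {\<omega> \<in> space M. op_norm (\<Sum>i=1..m. W i \<omega>) \<le> b}"
    proof
      fix \<omega> assume \<omega>: "\<omega> \<in> E"
      then have "(\<Sum>i=1..m. W i \<omega>) = (\<Sum>i=1..m. f i)"
        unfolding E_def by (intro sum.cong) auto
      moreover have "\<omega> \<in> space M" using \<omega> \<open>{1..m} \<noteq> {}\<close> by (auto simp: E_def)
      ultimately show "\<omega> \<in> {\<omega> \<in> space M. op_norm (\<Sum>i=1..m. W i \<omega>) \<le> b}"
        using f(2) by simp
    qed
    have "(\<lambda>\<omega>. \<Sum>i=1..m. W i \<omega>) \<in> borel_measurable M"
      using W_rv by (intro borel_measurable_sum) auto
    then have "(\<lambda>\<omega>. \<Sum>i=1..m. W i \<omega>) -` {A. op_norm A \<le> b} \<inter> space M \<in> events"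
      by (rule measurable_sets) (rule borel_closed[OF closed_op_norm_le])
    moreover have "(\<lambda>\<omega>. \<Sum>i=1..m. W i \<omega>) -` {A. op_norm A \<le> b} \<inter> space M
        = {\<omega> \<in> space M. op_norm (\<Sum>i=1..m. W i \<omega>) \<le> b}" by auto
    ultimately show "{\<omega> \<in> space M. op_norm (\<Sum>i=1..m. W i \<omega>) \<le> b} \<in> events" by simp
  qed
  finally show ?thesis unfolding b_def .
qed

end
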